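(* Consider the planar $n$-vortex problem with circulations $\Gamma_1,\dots,\Gamma_n$ satisfying $\Gamma_i > 0$ for all $i$, and let $z \in \mathbb{R}^{2n}$ be a relative equilibrium. Then the Morse index of $z$ is equal to the number of pairs of real (nonzero) eigenvalues $\pm\lambda_j$ of the corresponding periodic solution, i.e. of the stability matrix $B(z)$ (pairs counted with multiplicity).
   Context: Planar $n$-vortex problem: vortices at positions $z_i=(x_i,y_i)\in\mathbb{R}^2$ with nonzero real circulations $\Gamma_i$; $z=(z_1,\dots,z_n)\in\mathbb{R}^{2n}$, $r_{ij}=\|z_i-z_j\|$, and it is assumed that $\Gamma=\sum_i\Gamma_i\neq0$. Hamiltonian $H(z)=-\sum_{i<j}\Gamma_i\Gamma_j\ln r_{ij}$; equations of motion $\Gamma_i\dot z_i=J\,\partial H/\partial z_i$ with $J=\begin{bmatrix}0&1\\-1&0\end{bmatrix}$. Center of vorticity $c=\frac1\Gamma\sum_i\Gamma_iz_i$; angular impulse $I(z)=\sum_i\Gamma_i\|z_i-c\|^2$; $L=\sum_{i<j}\Gamma_i\Gamma_j$. A relative equilibrium is a configuration $z$ with pairwise distinct $z_i$ satisfying, for some $\omega\neq0$ (the angular velocity), $\sum_{j\ne i}\frac{\Gamma_i\Gamma_j}{r_{ij}^2}(z_j-z_i)+\omega\Gamma_i(z_i-c)=0$ for all $i$; it generates the periodic solution $z_i(t)=c+e^{-\omega Jt}(z_i-c)$. One has $\omega=L/I(z)$ when $I(z)\ne 0$. Let $M=\mathrm{diag}\{\Gamma_1,\Gamma_1,\dots,\Gamma_n,\Gamma_n\}$,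 let $K=\mathrm{diag}\{J,\dots,J\}$ ($2n\times2n$ block diagonal), let $D^2H(z)$ be the $2n\times2n$ matrix of second partial derivatives of $H$, and let $\mathrm{Id}$ be the $2n\times 2n$ identity matrix. Morse index of a relative equilibrium $z$: relative equilibria are the critical points of $H$ restricted to the set of configurations with fixed center of vorticity and fixed angular impulse. The Morse index is the dimension of the largest subspace of the tangent space at $z$ of this constraint set (center of vorticity equal to that of $z$, angular impulse equal to $I(z)$) on which the Hessian quadratic form $v\mapsto v^T(D^2H(z)+\omega M)v$ is negative definite. Stability matrix: $B(z)=K(M^{-1}D^2H(z)+\omega\,\mathrm{Id})$, the linearization about $z$ in uniformly rotating coordinates; its eigenvalues are what is meant by the eigenvalues of the corresponding periodic solution, and they occur in pairs $\pm\lambda$. Translating or scaling $z$ changes neither the index nor the type of the eigenvalues; for the normalization $c=0$, $I(z)=1$ one has $\omega=L$. *)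

theory Defs
  imports "HOL-Analysis.Analysis" "HOL-Computational_Algebra.Polynomial"
begin

text \<open>
  The number of vortices is the cardinality of the index type 'n. A point of \<open>\<real>\<^sup>2\<^sup>n\<close> is a
  vector indexed by 'n \<times> 2, so that the coordinates \<open>(i, 1)\<close> and \<open>(i, 2)\<close> are \<open>x\<^sub>i\<close> and \<open>y\<^sub>i\<close>.
  The linear order on 'n is used only to write sums over \<open>i < j\<close>.
\<close>

definition pos :: "real ^ ('n \<times> 2) \<Rightarrow> 'n::finite \<Rightarrow> real ^ 2" where
  "pos z i = (\<chi> k. z $ (i, k))"

definition hamiltonian :: "('n::{finite,linorder} \<Rightarrow> real) \<Rightarrow> real ^ ('n \<times> 2) \<Rightarrow> real" where
  "hamiltonian \<Gamma> z = - (\<Sum>(i, j) | i < j. \<Gamma> i * \<Gamma> j * ln (dist (pos z i) (pos z j)))"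

definition vorticity_center :: "('n::finite \<Rightarrow> real) \<Rightarrow> real ^ ('n \<times> 2) \<Rightarrow> real ^ 2" where
  "vorticity_center \<Gamma> z = (1 / (\<Sum>i\<in>UNIV. \<Gamma> i)) *\<^sub>R (\<Sum>i\<in>UNIV. \<Gamma> i *\<^sub>R pos z i)"

definition angular_impulse :: "('n::finite \<Rightarrow> real) \<Rightarrow> real ^ ('n \<times> 2) \<Rightarrow> real" where
  "angular_impulse \<Gamma> z = (\<Sum>i\<in>UNIV. \<Gamma> i * (norm (pos z i - vorticity_center \<Gamma> z))\<^sup>2)"

definition relative_equilibrium ::
  "('n::finite \<Rightarrow> real) \<Rightarrow> real \<Rightarrow> real ^ ('n \<times> 2) \<Rightarrow> bool" where
  "relative_equilibrium \<Gamma> \<omega> z \<longleftrightarrow>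
     inj (pos z) \<and> \<omega> \<noteq> 0 \<and>
     (\<forall>i. (\<Sum>j\<in>UNIV - {i}. (\<Gamma> i * \<Gamma> j / (dist (pos z i) (pos z j))\<^sup>2) *\<^sub>R (pos z j - pos z i))
           + (\<omega> * \<Gamma> i) *\<^sub>R (pos z i - vorticity_center \<Gamma> z) = 0)"

definition partial_deriv :: "'m::finite \<Rightarrow> (real ^ 'm \<Rightarrow> real) \<Rightarrow> real ^ 'm \<Rightarrow> real" where
  "partial_deriv p f z = deriv (\<lambda>t. f (z + t *\<^sub>R axis p 1)) 0"

definition hessian :: "(real ^ 'm \<Rightarrow> real) \<Rightarrow> real ^ 'm \<Rightarrow> real ^ 'm ^ 'm::finite" where
  "hessian f z = (\<chi> p q. partial_deriv p (partial_deriv q f) z)"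

definition circulation_matrix ::
  "('n::finite \<Rightarrow> real) \<Rightarrow> real ^ ('n \<times> 2) ^ ('n \<times> 2)" where
  "circulation_matrix \<Gamma> = (\<chi> p q. if p = q then \<Gamma> (fst p) else 0)"

definition J_mat :: "real ^ 2 ^ 2" where
  "J_mat = vector [vector [0, 1], vector [-1, 0]]"

definition K_mat :: "real ^ ('n \<times> 2) ^ ('n::finite \<times> 2)" where
  "K_mat = (\<chi> p q. if fst p = fst q then J_mat $ snd p $ snd q else 0)"

definition stability_matrix ::
  "('n::{finite,linorder} \<Rightarrow> real) \<Rightarrow> real \<Rightarrow> real ^ ('n \<times> 2) \<Rightarrow> real ^ ('n \<times> 2) ^ ('n \<times> 2)"
where
  "stability_matrix \<Gamma> \<omega> z =
     K_mat ** (matrix_inv (circulation_matrix \<Gamma>) ** hessian (hamiltonian \<Gamma>) z + \<omega> *\<^sub>R mat 1)"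

definition constraint_set ::
  "('n::finite \<Rightarrow> real) \<Rightarrow> real ^ ('n \<times> 2) \<Rightarrow> (real ^ ('n \<times> 2)) set" where
  "constraint_set \<Gamma> z =
     {w. vorticity_center \<Gamma> w = vorticity_center \<Gamma> z \<and> angular_impulse \<Gamma> w = angular_impulse \<Gamma> z}"

text \<open>
  Tangent vectors are the velocities of curves in \<open>S\<close> through \<open>z\<close>; for a smooth submanifold this
  is the usual tangent space.
\<close>

definition tangent_space :: "'a::real_normed_vector set \<Rightarrow> 'a \<Rightarrow> 'a set" where
  "tangent_space S z =
     {v. \<exists>\<gamma> \<epsilon>. 0 < \<epsilon> \<and> \<gamma> ` {-\<epsilon><..<\<epsilon>} \<subseteq> S \<and> \<gamma> 0 = z \<and> (\<gamma> has_vector_derivative v) (at (0::real))}"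

definition morse_index ::
  "('n::{finite,linorder} \<Rightarrow> real) \<Rightarrow> real \<Rightarrow> real ^ ('n \<times> 2) \<Rightarrow> nat" where
  "morse_index \<Gamma> \<omega> z =
     Max {dim V | V. subspace V \<and> V \<subseteq> tangent_space (constraint_set \<Gamma> z) z \<and>
       (\<forall>v\<in>V. v \<noteq> 0 \<longrightarrow>
          v \<bullet> ((hessian (hamiltonian \<Gamma>) z + \<omega> *\<^sub>R circulation_matrix \<Gamma>) *v v) < 0)}"

definition is_eigenvalue :: "real ^ 'm ^ 'm::finite \<Rightarrow> real \<Rightarrow> bool" where
  "is_eigenvalue A \<mu> \<longleftrightarrow> (\<exists>v. v \<noteq> 0 \<and> A *v v = \<mu> *\<^sub>R v)"

definition charpoly :: "real ^ 'm ^ 'm::finite \<Rightarrow> real poly" where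
  "charpoly A = det (\<chi> i j. (if i = j then [:0, 1:] else 0) - [:A $ i $ j:])"

text \<open>
  Real eigenvalue pairs \<open>\<plusminus>\<lambda>\<close> are indexed by their positive member, and counted with the algebraic
  multiplicity. This is meaningful for matrices, such as the stability matrix, whose spectrum
  is symmetric under \<open>\<lambda> \<mapsto> -\<lambda>\<close>.
\<close>

definition num_real_eigenvalue_pairs :: "real ^ 'm ^ 'm::finite \<Rightarrow> nat" where
  "num_real_eigenvalue_pairs A = (\<Sum>\<mu> | 0 < \<mu> \<and> is_eigenvalue A \<mu>. order \<mu> (charpoly A))"

end

theory Submission
  imports Defs
begin

text \<open>
  Put \<open>A = M\<^bsup>-1/2\<^esup> D\<^sup>2H M\<^bsup>-1/2\<^esup>\<close>. Since \<open>ln \<parallel>p\<parallel>\<close> is harmonic on the plane, \<open>A\<close> anticommutes with \<open>K\<close>, so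
  its eigenvalues come in pairs \<open>\<plusminus>\<mu>\<close>, and on the plane spanned by an eigenvector \<open>v\<close> and \<open>K v\<close> the matrix
  \<open>K (A + \<omega>)\<close>, which is similar to \<open>B(z)\<close>, squares to \<open>\<mu>\<^sup>2 - \<omega>\<^sup>2\<close>. Hence the pairs of real nonzero
  eigenvalues of \<open>B(z)\<close> correspond to the eigenvalues of \<open>A\<close> below \<open>-\<bar>\<omega>\<bar>\<close>. For at least two vortices
  \<open>\<omega> > 0\<close>, so the number of these is the negative index of \<open>A + \<omega>\<close>, that is, of \<open>D\<^sup>2H + \<omega> M\<close> on the
  whole space. Restricting to the tangent space does not change it: the normal directions
  are the translations and \<open>z - c\<close>, eigenvectors of \<open>M\<^sup>-\<^sup>1 D\<^sup>2H\<close> for the eigenvalues \<open>0\<close> and \<open>\<omega>\<close>, where the form is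
  positive. For a single vortex \<open>\<omega>\<close> may be negative, but then the tangent space is trivial.
\<close>

section \<open>Diagonalization of symmetric matrices\<close>

lemma inner_matrix_vector_transpose:
  fixes A :: "real ^ 'n ^ 'm"
  shows "(A *v x) \<bullet> y = x \<bullet> (transpose A *v y)"
  using dot_lmul_matrix[of x "transpose A" y] transpose_matrix_vector[of "transpose A" x]
  by (simp del: transpose_matrix_vector)

text \<open>A maximiser \<open>u\<close> of the Rayleigh quotient on the compact unit sphere of
  \<open>U\<close> is an eigenvector: the residual \<open>w = \<mu> *\<^sub>R u - A *v u\<close>
  lies in \<open>U\<close> by invariance, and if it were nonzero, a small step along it would
  violate maximality.\<close>

lemma rayleigh_maximiser:
  fixes A :: "real ^ 'm ^ 'm::finite"
  assumes sym: "transpose A = A" and U: "subspace U" "U \<noteq> {0}" and inv: "\<And>u. u \<in> U \<Longrightarrow> A *v u \<in> U"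
  obtains u \<mu> where "u \<in> U" "norm u = 1" "A *v u = \<mu> *\<^sub>R u"
proof -
  have dotA: "(A *v x) \<bullet> y = x \<bullet> (A *v y)" for x y
    by (simp add: inner_matrix_vector_transpose sym del: transpose_matrix_vector)
  let ?S = "U \<inter> sphere 0 1"
  have comp: "compact ?S"
    using closed_subspace[OF U(1)] compact_sphere by (simp add: closed_Int_compact)
  obtain x where "x \<in> U" "x \<noteq> 0" using U subspace_0 by blast
  then have "x /\<^sub>R norm x \<in> ?S" using U(1) by (simp add: subspace_scale)
  then have ne: "?S \<noteq> {}" by blast
  have cont: "continuous_on ?S (\<lambda>u. u \<bullet> (A *v u))"
    by (intro continuous_intros)
  obtain u where u: "u \<in> ?S" and max: "\<And>v. v \<in> ?S \<Longrightarrow> v \<bullet> (A *v v) \<le> u \<bullet> (A *v u)"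
    using continuous_attains_sup[OF comp ne cont] by blast
  define \<mu> where "\<mu> = u \<bullet> (A *v u)"
  have nonneg: "v \<bullet> (A *v v) \<le> \<mu> * (v \<bullet> v)" if "v \<in> U" for v
  proof (cases "v = 0")
    case False
    have "(v /\<^sub>R norm v) \<bullet> (A *v (v /\<^sub>R norm v)) \<le> \<mu>"
      unfolding \<mu>_def using that U(1) False by (intro max) (simp add: subspace_scale)
    moreover have "(v /\<^sub>R norm v) \<bullet> (A *v (v /\<^sub>R norm v)) = (v \<bullet> (A *v v)) / (norm v)\<^sup>2"
      by (simp add: matrix_vector_mult_scaleR power2_eq_square divide_inverse)
    ultimately have "(v \<bullet> (A *v v)) / (norm v)\<^sup>2 \<le> \<mu>" by simp
    with False show ?thesis by (simp add: field_simps power2_norm_eq_inner)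
  qed simp
  define w where "w = \<mu> *\<^sub>R u - A *v u"
  have wU: "w \<in> U" using u U(1) inv by (simp add: w_def subspace_diff subspace_scale)
  have uu: "u \<bullet> u = 1" using u by (simp add: norm_eq_1)
  \<comment> \<open>This is \<open>nonneg\<close> at \<open>u + t *\<^sub>R w\<close>: the constant
    terms cancel, and the coefficient of \<open>t\<close> is \<open>2 * (w \<bullet> w)\<close>
    because \<open>w\<close> is the residual itself.\<close>
  have quadratic: "0 \<le> 2 * t * (w \<bullet> w) + t\<^sup>2 * (\<mu> * (w \<bullet> w) - w \<bullet> (A *v w))" for t
  proof -
    have "u + t *\<^sub>R w \<in> U" using u wU U(1) by (simp add: subspace_add subspace_scale)
    moreover have "u \<bullet> (A *v w) = w \<bullet> (A *v u)" using dotA[of w u] inner_commute[of "A *v w" u] by simp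
    moreover have "u \<bullet> w = w \<bullet> u" by (rule inner_commute)
    ultimately have
      "\<mu> + 2 * t * (w \<bullet> (A *v u)) + t\<^sup>2 * (w \<bullet> (A *v w)) \<le> \<mu> * (1 + 2 * t * (w \<bullet> u) + t\<^sup>2 * (w \<bullet> w))"
      using nonneg[of "u + t *\<^sub>R w"] uu
      by (simp add: algebra_simps inner_simps matrix_vector_mult_scaleR matrix_vector_right_distrib
          \<mu>_def[symmetric] power2_eq_square)
    note 1 = this
    have 2: "w \<bullet> w = \<mu> * (w \<bullet> u) - w \<bullet> (A *v u)"
      using inner_diff_right[of w "\<mu> *\<^sub>R u" "A *v u"] by (simp add: w_def[symmetric])
    have "2 * t * (w \<bullet> w) = 2 * t * (\<mu> * (w \<bullet> u)) - 2 * t * (w \<bullet> (A *v u))"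
      by (simp only: 2 right_diff_distrib)
    with 1 show ?thesis by (simp add: algebra_simps)
  qed
  have "w \<bullet> w = 0"
  proof (rule ccontr)
    define a where "a = w \<bullet> w"
    define b where "b = \<mu> * (w \<bullet> w) - w \<bullet> (A *v w)"
    assume "w \<bullet> w \<noteq> 0"
    then have a: "a > 0" by (simp add: a_def)
    define s where "s = \<bar>b\<bar> + 1"
    have s: "s > 0" "b < s" by (auto simp: s_def)
    \<comment> \<open>The negative sign makes the linear term \<open>- 2 * a\<^sup>2 / s\<close>,
      and \<open>b < s\<close> keeps the quadratic term below \<open>a\<^sup>2 / s\<close>, so the
      sum is negative.\<close>
    define t where "t = - a / s"
    have "0 \<le> 2 * t * a + t\<^sup>2 * b" using quadratic by (simp add: a_def b_def)
    also have "\<dots> = (a\<^sup>2 / s) * (b / s - 2)"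
      using s by (simp add: t_def power2_eq_square divide_simps) (simp add: algebra_simps)
    also have "\<dots> < 0" using a s by (intro mult_pos_neg) (auto simp: divide_simps)
    finally show False by simp
  qed
  then have "A *v u = \<mu> *\<^sub>R u" by (simp add: w_def)
  with u that show thesis by auto
qed

text \<open>A largest orthonormal set of eigenvectors spans the space: by symmetry its orthogonal
  complement is invariant under \<open>A\<close>, so a nonzero complement would contain a further
  unit eigenvector. The columns of \<open>P\<close> are the members of this set.\<close>

theorem symmetric_matrix_diagonalization:
  fixes A :: "real ^ 'm ^ 'm::finite"
  assumes sym: "transpose A = A"
  obtains P d where "orthogonal_matrix P" "A ** P = P ** (\<chi> i j. if i = j then d i else 0)"
proof -
  have dotA: "(A *v x) \<bullet> y = x \<bullet> (A *v y)" for x y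
    by (simp add: inner_matrix_vector_transpose sym del: transpose_matrix_vector)
  define good where "good B \<longleftrightarrow> pairwise orthogonal B \<and>
     (\<forall>u\<in>B. norm u = 1 \<and> (\<exists>\<mu>. A *v u = \<mu> *\<^sub>R u))" for B :: "(real ^ 'm) set"
  have ind: "independent B" if "good B" for B
    using that unfolding good_def by (intro pairwise_orthogonal_independent) auto
  have "\<exists>B. good B \<and> (\<forall>B'. good B' \<longrightarrow> card B' \<le> card B)"
  proof (rule ex_has_greatest_nat)
    show "good {}" by (simp add: good_def)
    show "\<forall>B. good B \<longrightarrow> card B < Suc CARD('m)"
      using ind independent_bound by (fastforce simp: less_Suc_eq_le)
  qed
  then obtain B where B: "good B" and Bmax: "\<And>B'. good B' \<Longrightarrow> card B' \<le> card B" by blast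
  have finB: "finite B" using ind[OF B] independent_bound by blast
  define U where "U = {v. \<forall>u\<in>B. u \<bullet> v = 0}"
  have "U = {0}"
  proof (rule ccontr)
    assume "U \<noteq> {0}"
    moreover have "subspace U"
      by (auto simp: U_def subspace_def inner_simps)
    moreover have "A *v v \<in> U" if "v \<in> U" for v
    proof -
      have "u \<bullet> (A *v v) = 0" if u: "u \<in> B" for u
      proof -
        obtain \<mu> where "A *v u = \<mu> *\<^sub>R u" using B u by (auto simp: good_def)
        then have "u \<bullet> (A *v v) = \<mu> * (u \<bullet> v)" by (simp add: dotA[symmetric])
        then show ?thesis using \<open>v \<in> U\<close> u by (simp add: U_def)
      qed
      then show ?thesis by (simp add: U_def)
    qed
    ultimately obtain u \<mu> where u: "u \<in> U" "norm u = 1" "A *v u = \<mu> *\<^sub>R u"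
      using rayleigh_maximiser[OF sym] by metis
    have "u \<notin> B" using u by (auto simp: U_def)
    have "good (insert u B)"
      using B u by (auto simp: good_def pairwise_insert U_def orthogonal_def inner_commute)
    from Bmax[OF this] \<open>u \<notin> B\<close> finB show False by simp
  qed
  have "span B = UNIV"
  proof -
    have "v \<in> span B" for v
    proof -
      define w where "w = v - (\<Sum>u\<in>B. (u \<bullet> v) *\<^sub>R u)"
      have "u \<bullet> w = 0" if u: "u \<in> B" for u
      proof -
        have "u \<bullet> (\<Sum>u'\<in>B. (u' \<bullet> v) *\<^sub>R u') = (\<Sum>u'\<in>B. if u' = u then u \<bullet> v else 0)"
          unfolding inner_sum_right
          using B u by (intro sum.cong) (auto simp: good_def pairwise_def orthogonal_def norm_eq_1)
        then show ?thesis using u finB by (simp add: w_def inner_simps)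
      qed
      then have "w = 0" using \<open>U = {0}\<close> by (auto simp: U_def)
      then have "v = (\<Sum>u\<in>B. (u \<bullet> v) *\<^sub>R u)" by (simp add: w_def)
      then show ?thesis by (metis (no_types, lifting) span_base span_scale span_sum)
    qed
    then show ?thesis by blast
  qed
  then have "card B = CARD('m)"
    using ind[OF B] by (metis DIM_cart DIM_real dim_UNIV dim_eq_card_independent dim_span nat_mult_1_right)
  then obtain e where e: "bij_betw e (UNIV :: 'm set) B"
    using finB finite_same_card_bij by (metis finite)
  define P :: "real ^ 'm ^ 'm" where "P = (\<chi> i j. e j $ i)"
  have colP: "column j P = e j" for j by (simp add: P_def column_def vec_eq_iff)
  have eB: "e j \<in> B" for j using e by (auto simp: bij_betw_def)
  have "orthogonal_matrix P"
    unfolding orthogonal_matrix_orthonormal_columns colP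
    using B eB e by (auto simp: good_def pairwise_def bij_betw_def inj_eq)
  moreover have "\<forall>j. \<exists>\<mu>. A *v e j = \<mu> *\<^sub>R e j"
    using B eB by (auto simp: good_def)
  then obtain d where d: "\<And>j. A *v e j = d j *\<^sub>R e j" by metis
  have "A ** P = P ** (\<chi> i j. if i = j then d i else 0)"
  proof -
    have "(A ** P) $ i $ j = (A *v e j) $ i" for i j
      by (simp add: matrix_matrix_mult_def matrix_vector_mult_def P_def)
    moreover have "(P ** (\<chi> i j. if i = j then d i else 0)) $ i $ j = d j * e j $ i" for i j
      by (simp add: matrix_matrix_mult_def P_def if_distrib[of "\<lambda>x. _ * x"] cong: if_cong)
    ultimately show ?thesis by (simp add: vec_eq_iff d)
  qed
  ultimately show thesis using that by blast
qed

section \<open>Characteristic polynomials and real eigenvalue pairs\<close>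

lemma matrix_mul_add_rdistrib: "((A :: 'a::semiring_1 ^ 'm ^ 'n) + B) ** C = A ** C + B ** C"
  by (simp add: matrix_matrix_mult_def vec_eq_iff sum.distrib distrib_right)

lemma matrix_mul_minus_left: "(- (A :: 'a::ring_1 ^ 'm ^ 'n)) ** B = - (A ** B)"
  by (simp add: matrix_matrix_mult_def vec_eq_iff sum_negf)

lemma matrix_mul_minus_right: "(A :: 'a::ring_1 ^ 'm ^ 'n) ** (- B) = - (A ** B)"
  by (simp add: matrix_matrix_mult_def vec_eq_iff sum_negf)

lemma matrix_mul_diff_rdistrib: "((A :: 'a::ring_1 ^ 'm ^ 'n) - B) ** C = A ** C - B ** C"
  using matrix_mul_add_rdistrib[of A "- B" C] by (simp add: matrix_mul_minus_left)

lemma matrix_mul_diff_ldistrib: "(A :: 'a::ring_1 ^ 'm ^ 'n) ** (B - C) = A ** B - A ** C"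
  using matrix_add_ldistrib[of A B "- C"] by (simp add: matrix_mul_minus_right)

lemma matrix_mul_scaleR_left: "(k *\<^sub>R (A :: real ^ 'm ^ 'n)) ** B = k *\<^sub>R (A ** B)"
  by (simp add: scalar_matrix_assoc)

lemma matrix_mul_scaleR_right: "(A :: real ^ 'm ^ 'n) ** (k *\<^sub>R B) = k *\<^sub>R (A ** B)"
  by (simp add: matrix_scalar_ac scalar_matrix_assoc)

text \<open>A one-sided inverse of a square matrix is two-sided, so the choice in the definition of
  \<open>matrix_inv\<close> ranges over a nonempty set, and associativity identifies its value with
  \<open>B\<close>.\<close>

lemma matrix_inv_unique:
  fixes A B :: "'a::field ^ 'n ^ 'n"
  assumes "A ** B = mat 1"
  shows "matrix_inv A = B"
proof -
  have "B ** A = mat 1" using assms by (simp only: matrix_left_right_inverse)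
  with assms have "A ** matrix_inv A = mat 1 \<and> matrix_inv A ** A = mat 1"
    unfolding matrix_inv_def
    by (intro someI[where P = "\<lambda>A'. A ** A' = mat 1 \<and> A' ** A = mat 1" and x = B] conjI)
  then have "matrix_inv A ** A ** B = B" by simp
  then show ?thesis by (simp add: matrix_mul_assoc[symmetric] assms)
qed

lemma transpose_linear:
  shows transpose_add: "transpose (A + B) = transpose A + transpose B"
    and transpose_minus: "transpose (- C :: 'a::ring_1 ^ 'm ^ 'n) = - transpose C"
    and transpose_diff: "transpose (C - D :: 'a::ring_1 ^ 'm ^ 'n) = transpose C - transpose D"
  by (simp_all add: transpose_def vec_eq_iff)

lemmas matrix_ring_simps = matrix_add_ldistrib matrix_mul_add_rdistrib matrix_mul_minus_left
  matrix_mul_minus_right matrix_mul_diff_rdistrib matrix_mul_diff_ldistrib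
  matrix_mul_scaleR_left matrix_mul_scaleR_right

text \<open>Evaluation at \<open>x\<close> is a ring homomorphism and passes through the Leibniz
  expansion. Identities between characteristic polynomials can then be checked at every real
  \<open>x\<close> as identities of determinants.\<close>

lemma poly_charpoly: "poly (charpoly A) x = det (x *\<^sub>R mat 1 - A)"
proof -
  have "poly (charpoly A) x
      = (\<Sum>p\<in>{p. p permutes UNIV}. of_int (sign p) * (\<Prod>i\<in>UNIV. (if i = p i then x else 0) - A $ i $ p i))"
    unfolding charpoly_def det_def
    by (simp add: poly_sum poly_prod if_distrib[of "\<lambda>q. poly q x"] cong: if_cong)
  also have "\<dots> = det (x *\<^sub>R mat 1 - A)"
    unfolding det_def by (simp add: mat_def if_distrib[of "\<lambda>q. x * q"] cong: if_cong)
  finally show ?thesis .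
qed

lemma is_eigenvalue_iff_root: "is_eigenvalue A \<mu> \<longleftrightarrow> poly (charpoly A) \<mu> = 0"
proof -
  have "is_eigenvalue A \<mu> \<longleftrightarrow> (\<exists>v. v \<noteq> 0 \<and> (\<mu> *\<^sub>R mat 1 - A) *v v = 0)"
    by (auto simp: is_eigenvalue_def matrix_vector_mult_diff_rdistrib scaleR_matrix_vector_assoc[symmetric])
  also have "\<dots> \<longleftrightarrow> \<not> invertible (\<mu> *\<^sub>R mat 1 - A)"
    unfolding invertible_left_inverse matrix_left_invertible_ker by blast
  also have "\<dots> \<longleftrightarrow> det (\<mu> *\<^sub>R mat 1 - A) = 0"
    using invertible_det_nz by blast
  finally show ?thesis by (simp add: poly_charpoly)
qed

lemma det_similar:
  fixes A S T :: "'a::comm_ring_1 ^ 'm ^ 'm"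
  assumes "S ** T = mat 1"
  shows "det (S ** A ** T) = det A"
proof -
  have "det S * det T = 1" by (metis assms det_I det_mul)
  then show ?thesis by (simp add: det_mul mult.assoc mult.commute[of "det A"]) (simp add: mult.assoc[symmetric])
qed

lemma charpoly_similar:
  fixes A S T :: "real ^ 'm ^ 'm"
  assumes "S ** T = mat 1"
  shows "charpoly (S ** A ** T) = charpoly A"
proof (rule poly_ext)
  fix x
  have "x *\<^sub>R mat 1 - S ** A ** T = S ** (x *\<^sub>R mat 1 - A) ** T"
    using assms by (simp add: matrix_ring_simps)
  then show "poly (charpoly (S ** A ** T)) x = poly (charpoly A) x"
    by (simp only: poly_charpoly det_similar[OF assms])
qed

text \<open>Being an eigenvalue is itself a property of the characteristic polynomial, so the count
  is a similarity invariant.\<close>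

lemma num_real_eigenvalue_pairs_charpoly_cong:
  "charpoly A = charpoly B \<Longrightarrow> num_real_eigenvalue_pairs A = num_real_eigenvalue_pairs B"
  by (simp add: num_real_eigenvalue_pairs_def is_eigenvalue_iff_root)

lemma charpoly_orthogonally_diagonalized:
  fixes A P :: "real ^ 'm ^ 'm::finite"
  assumes "orthogonal_matrix P" "A ** P = P ** (\<chi> i j. if i = j then d i else 0)"
  shows "charpoly A = (\<Prod>i\<in>UNIV. [:- d i, 1:])"
proof -
  let ?D = "(\<chi> i j. if i = j then d i else 0) :: real ^ 'm ^ 'm"
  have "A = P ** ?D ** transpose P"
    using assms by (metis matrix_mul_assoc matrix_mul_rid orthogonal_matrix_def)
  then have "charpoly A = charpoly ?D"
    using charpoly_similar[of P "transpose P" ?D] assms(1) by (simp add: orthogonal_matrix_def)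
  also have "\<dots> = (\<Prod>i\<in>UNIV. [:- d i, 1:])"
  proof (rule poly_ext)
    fix x
    show "poly (charpoly ?D) x = poly (\<Prod>i\<in>UNIV. [:- d i, 1:]) x"
      unfolding poly_charpoly by (subst det_diagonal) (auto simp: mat_def poly_prod)
  qed
  finally show ?thesis .
qed

section \<open>Root multiplicities of products of linear and quadratic factors\<close>

lemma order_prod:
  assumes "finite I" "\<And>i. i \<in> I \<Longrightarrow> f i \<noteq> 0"
  shows "order a (\<Prod>i\<in>I. f i) = (\<Sum>i\<in>I. order a (f i))"
  using assms by (induction I) (auto simp: order_mult)

lemma order_linear_factor:
  fixes a b :: "'a::field"
  shows "order a [:- b, 1:] = (if a = b then 1 else 0)"
  using order_power_n_n[of a 1] by (auto intro: order_0I)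

lemma order_prod_linear_factors:
  fixes d :: "'m::finite \<Rightarrow> 'a::field"
  shows "order a (\<Prod>i\<in>UNIV. [:- d i, 1:]) = card {i. d i = a}"
  by (subst order_prod) (auto simp: order_linear_factor sum.If_cases eq_commute[of a])

text \<open>If \<open>b = a\<^sup>2\<close>, the polynomial splits with roots \<open>a\<close> and
  \<open>- a\<close>, which differ because \<open>a > 0\<close>; otherwise \<open>a\<close> is no
  root.\<close>

lemma order_even_quadratic:
  fixes a b :: real
  assumes "a > 0"
  shows "order a [:- b, 0, 1:] = (if b = a\<^sup>2 then 1 else 0)"
proof (cases "b = a\<^sup>2")
  case True
  then have "[:- b, 0, 1:] = [:- a, 1:] * [:- (- a), 1:]"
    by (simp add: power2_eq_square)
  moreover have "[:- b, 0, 1:] \<noteq> 0" by simp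
  ultimately have "order a [:- b, 0, 1:] = order a [:- a, 1:] + order a [:- (- a), 1:]"
    by (metis order_mult)
  then show ?thesis using assms True by (simp only: order_linear_factor) simp
qed (auto intro!: order_0I simp: power2_eq_square)

text \<open>
  Conjugation by \<open>K\<close> turns \<open>A\<close> into \<open>-A\<close>, so the spectrum \<open>d\<close> is symmetric; and
  \<open>C = K (A + \<omega>)\<close> satisfies \<open>C\<^sup>2 = A\<^sup>2 - \<omega>\<^sup>2\<close>. As \<open>C\<^sup>T\<close> is similar to \<open>-C\<close>, this gives
  \<open>(det (x - C))\<^sup>2 = det (x\<^sup>2 + \<omega>\<^sup>2 - A\<^sup>2)\<close>.
\<close>

theorem num_real_eigenvalue_pairs_anticommuting:
  fixes A K P :: "real ^ 'm ^ 'm::finite"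
  assumes sym: "transpose A = A"
    and P: "orthogonal_matrix P" "A ** P = P ** (\<chi> i j. if i = j then d i else 0)"
    and K2: "K ** K = - mat 1" and Kt: "transpose K = - K" and KA: "K ** A = - (A ** K)"
  shows "num_real_eigenvalue_pairs (K ** (A + \<omega> *\<^sub>R mat 1)) = card {i. d i < - \<bar>\<omega>\<bar>}"
proof -
  let ?D = "(\<chi> i j. if i = j then d i else 0) :: real ^ 'm ^ 'm"
  define C where "C = K ** (A + \<omega> *\<^sub>R mat 1)"
  define p where "p = charpoly C"
  have KnK: "K ** (- K) = mat 1" by (simp add: matrix_mul_minus_right K2)
  have KAK: "K ** A ** K = A"
    by (simp add: KA matrix_ring_simps matrix_mul_assoc[symmetric] K2)
  have AKK: "A ** K ** K = - A"
    by (simp add: matrix_ring_simps matrix_mul_assoc[symmetric] K2)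
  have cA: "charpoly A = (\<Prod>i\<in>UNIV. [:- d i, 1:])"
    using charpoly_orthogonally_diagonalized[OF P] .
  have "(- A) ** P = P ** (\<chi> i j. if i = j then - d i else 0)"
  proof -
    have "(\<chi> i j. if i = j then - d i else 0) = - ?D" by (simp add: vec_eq_iff)
    then show ?thesis using P(2) by (simp add: matrix_ring_simps)
  qed
  from charpoly_orthogonally_diagonalized[OF P(1) this]
  have cnA: "charpoly (- A) = (\<Prod>i\<in>UNIV. [:- (- d i), 1:])" .
  have "K ** A ** (- K) = - A"
    by (simp add: matrix_ring_simps KAK)
  then have "charpoly (- A) = charpoly A"
    using charpoly_similar[OF KnK, of A] by simp
  \<comment> \<open>Both characteristic polynomials are products of linear factors; comparing the
    order of the root \<open>s\<close> in them compares the multiplicities of \<open>s\<close> in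
    \<open>d\<close> and in \<open>- d\<close>.\<close>
  then have symm: "card {i. d i = - s} = card {i. d i = s}" for s
  proof -
    have "card {i. d i = s} = card {i. - d i = s}"
      using \<open>charpoly (- A) = charpoly A\<close> unfolding cA cnA by (metis order_prod_linear_factors)
    moreover have "{i. - d i = s} = {i. d i = - s}" by auto
    ultimately show ?thesis by simp
  qed
  have detC: "det (x *\<^sub>R mat 1 + C) = det (x *\<^sub>R mat 1 - C)" for x
  proof -
    have "transpose C = - ((A + \<omega> *\<^sub>R mat 1) ** K)"
      by (simp add: C_def matrix_transpose_mul transpose_add transpose_scalar sym Kt matrix_ring_simps)
    then have "K ** transpose (x *\<^sub>R mat 1 - C) ** (- K) = x *\<^sub>R mat 1 + C"
      by (simp add: transpose_diff transpose_scalar matrix_ring_simps K2 KA AKK C_def matrix_mul_assoc)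
    then show ?thesis using det_similar[OF KnK] by (metis det_transpose)
  qed
  have p2: "p * p = (\<Prod>i\<in>UNIV. [:- ((d i)\<^sup>2 - \<omega>\<^sup>2), 0, 1:])"
  proof (rule poly_ext)
    fix x
    \<comment> \<open>For real \<open>x\<close> the number
      \<open>x\<^sup>2 + \<omega>\<^sup>2\<close> has a real square root \<open>y\<close>, so
      \<open>y\<^sup>2 - A\<^sup>2\<close> factors as \<open>(y - A) (y + A)\<close>, whose
      determinants are values of the known characteristic polynomials of \<open>A\<close> and
      \<open>- A\<close>.\<close>
    define y where "y = sqrt (x\<^sup>2 + \<omega>\<^sup>2)"
    have y2: "y * y = x * x + \<omega> * \<omega>" by (simp add: y_def power2_eq_square[symmetric])
    have "C ** C = A ** A - (\<omega> * \<omega>) *\<^sub>R mat 1"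
    proof -
      have "C ** C = (K ** A ** K) ** A + \<omega> *\<^sub>R (K ** A ** K) + \<omega> *\<^sub>R ((K ** K) ** A) + (\<omega> * \<omega>) *\<^sub>R (K ** K)"
        by (simp add: C_def matrix_ring_simps matrix_mul_assoc algebra_simps)
      then show ?thesis by (simp add: KAK K2 matrix_ring_simps)
    qed
    then have "(x *\<^sub>R mat 1 - C) ** (x *\<^sub>R mat 1 + C) = (y *\<^sub>R mat 1 - A) ** (y *\<^sub>R mat 1 - (- A))"
      by (simp add: matrix_ring_simps y2 scaleR_add_left scaleR_diff_right)
    then have "det (x *\<^sub>R mat 1 - C) * det (x *\<^sub>R mat 1 + C)
        = poly (charpoly A) y * poly (charpoly (- A)) y"
      unfolding poly_charpoly by (simp only: det_mul[symmetric])
    then have "poly (p * p) x = (\<Prod>i\<in>UNIV. y - d i) * (\<Prod>i\<in>UNIV. y + d i)"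
      unfolding detC cA cnA by (simp add: p_def poly_charpoly poly_prod add.commute)
    also have "\<dots> = (\<Prod>i\<in>UNIV. x * x + \<omega> * \<omega> - d i * d i)"
      by (simp add: prod.distrib[symmetric] y2 algebra_simps)
    finally show "poly (p * p) x = poly (\<Prod>i\<in>UNIV. [:- ((d i)\<^sup>2 - \<omega>\<^sup>2), 0, 1:]) x"
      by (simp add: poly_prod power2_eq_square algebra_simps)
  qed
  then have p0: "p \<noteq> 0" by auto
  have order_p: "order \<mu> p = card {i. d i = - sqrt (\<mu>\<^sup>2 + \<omega>\<^sup>2)}" if "\<mu> > 0" for \<mu>
  proof -
    define s where "s = sqrt (\<mu>\<^sup>2 + \<omega>\<^sup>2)"
    have s: "s > 0" "s\<^sup>2 = \<mu>\<^sup>2 + \<omega>\<^sup>2" using that by (auto simp: s_def add_pos_nonneg)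
    \<comment> \<open>Passing to \<open>p * p\<close> doubles the order. By \<open>symm\<close> the
      indices with \<open>d i = s\<close> and those with \<open>d i = - s\<close> are equally many,
      so halving leaves exactly the latter.\<close>
    have "2 * order \<mu> p = order \<mu> (p * p)" using p0 by (simp add: order_mult)
    also have "\<dots> = (\<Sum>i\<in>UNIV. if (d i)\<^sup>2 - \<omega>\<^sup>2 = \<mu>\<^sup>2 then 1 else 0)"
      unfolding p2 by (subst order_prod; (simp only: order_even_quadratic[OF that])?; simp)
    also have "\<dots> = card {i. (d i)\<^sup>2 - \<omega>\<^sup>2 = \<mu>\<^sup>2}"
      by (simp add: sum.If_cases)
    also have "{i. (d i)\<^sup>2 - \<omega>\<^sup>2 = \<mu>\<^sup>2} = {i. d i = s} \<union> {i. d i = - s}"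
    proof -
      have "(d i)\<^sup>2 - \<omega>\<^sup>2 = \<mu>\<^sup>2 \<longleftrightarrow> d i = s \<or> d i = - s" for i
        using s(2) power2_eq_iff[of "d i" s] by auto
      then show ?thesis by auto
    qed
    also have "card \<dots> = card {i. d i = s} + card {i. d i = - s}"
      using s(1) by (intro card_Un_disjoint) auto
    finally show ?thesis using symm[of s] by (simp add: s_def)
  qed
  define R where "R = {\<mu>. 0 < \<mu> \<and> poly p \<mu> = 0}"
  have finR: "finite R"
    by (rule finite_subset[OF _ poly_roots_finite[OF p0]]) (auto simp: R_def)
  have "num_real_eigenvalue_pairs C = (\<Sum>\<mu>\<in>R. card {i. d i = - sqrt (\<mu>\<^sup>2 + \<omega>\<^sup>2)})"
    by (simp add: num_real_eigenvalue_pairs_def is_eigenvalue_iff_root p_def[symmetric] R_def order_p)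
  \<comment> \<open>On positive \<open>\<mu>\<close> the map to
    \<open>sqrt (\<mu>\<^sup>2 + \<omega>\<^sup>2)\<close> is injective, so distinct roots own
    disjoint sets of indices.\<close>
  also have "\<dots> = card (\<Union>\<mu>\<in>R. {i. d i = - sqrt (\<mu>\<^sup>2 + \<omega>\<^sup>2)})"
    using finR by (intro card_UN_disjoint[symmetric]) (auto simp: R_def power2_eq_iff)
  also have "(\<Union>\<mu>\<in>R. {i. d i = - sqrt (\<mu>\<^sup>2 + \<omega>\<^sup>2)}) = {i. d i < - \<bar>\<omega>\<bar>}"
  proof (intro set_eqI iffI)
    fix i assume "i \<in> (\<Union>\<mu>\<in>R. {i. d i = - sqrt (\<mu>\<^sup>2 + \<omega>\<^sup>2)})"
    then obtain \<mu> where "\<mu> > 0" "d i = - sqrt (\<mu>\<^sup>2 + \<omega>\<^sup>2)" by (auto simp: R_def)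
    moreover from this have "sqrt (\<omega>\<^sup>2) < sqrt (\<mu>\<^sup>2 + \<omega>\<^sup>2)" by (subst real_sqrt_less_iff) simp
    ultimately show "i \<in> {i. d i < - \<bar>\<omega>\<bar>}" by simp
  next
    fix i assume "i \<in> {i. d i < - \<bar>\<omega>\<bar>}"
    then have i: "\<bar>\<omega>\<bar> < - d i" by simp
    then have "\<bar>\<omega>\<bar>\<^sup>2 < (- d i)\<^sup>2" by (intro power_strict_mono) auto
    then have less: "\<omega>\<^sup>2 < (d i)\<^sup>2" by simp
    \<comment> \<open>This solves \<open>d i = - sqrt (\<mu>\<^sup>2 + \<omega>\<^sup>2)\<close> for
      \<open>\<mu>\<close>; it is a root of \<open>p\<close> because its order counts at least the
      index \<open>i\<close>.\<close>
    define \<mu> where "\<mu> = sqrt ((d i)\<^sup>2 - \<omega>\<^sup>2)"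
    have \<mu>: "\<mu> > 0" "\<mu>\<^sup>2 + \<omega>\<^sup>2 = (d i)\<^sup>2" using less by (auto simp: \<mu>_def)
    then have di: "d i = - sqrt (\<mu>\<^sup>2 + \<omega>\<^sup>2)" using i by simp
    then have "order \<mu> p \<noteq> 0" unfolding order_p[OF \<mu>(1)] by (auto simp: card_eq_0_iff)
    then have "\<mu> \<in> R" using \<mu>(1) p0 by (auto simp: R_def order_root)
    with di show "i \<in> (\<Union>\<mu>\<in>R. {i. d i = - sqrt (\<mu>\<^sup>2 + \<omega>\<^sup>2)})" by auto
  qed
  finally show ?thesis unfolding C_def .
qed

section \<open>The negative index of a shifted symmetric matrix\<close>

context
  fixes A P :: "real ^ 'm ^ 'm::finite" and d :: "'m \<Rightarrow> real"
  assumes P: "orthogonal_matrix P" "A ** P = P ** (\<chi> i j. if i = j then d i else 0)"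
begin

lemma inner_orthogonal_coordinates: "v \<bullet> w = (transpose P *v v) \<bullet> (transpose P *v w)"
proof -
  have "P ** transpose P = mat 1" using P(1) by (simp add: orthogonal_matrix_def)
  then show ?thesis
    by (simp add: inner_matrix_vector_transpose matrix_vector_mul_assoc del: transpose_matrix_vector)
qed

lemma eigencoordinates: "(transpose P *v (A *v v)) $ i = d i * (transpose P *v v) $ i"
proof -
  let ?D = "(\<chi> i j. if i = j then d i else 0) :: real ^ 'm ^ 'm"
  have PP: "P ** transpose P = mat 1" "transpose P ** P = mat 1"
    using P(1) by (simp_all add: orthogonal_matrix_def)
  have "transpose P ** A = transpose P ** (A ** P) ** transpose P"
    by (simp add: matrix_mul_assoc[symmetric] PP)
  also have "\<dots> = ?D ** transpose P"
    unfolding P(2) by (simp add: matrix_mul_assoc PP)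
  finally have "transpose P *v (A *v v) = ?D *v (transpose P *v v)"
    by (simp add: matrix_vector_mul_assoc del: transpose_matrix_vector)
  then show ?thesis
    by (simp add: matrix_vector_mult_def if_distrib[of "\<lambda>x. x * _"] cong: if_cong del: transpose_matrix_vector)
qed

lemma shifted_quadratic_form:
  "v \<bullet> ((A + \<omega> *\<^sub>R mat 1) *v v) = (\<Sum>i\<in>UNIV. (d i + \<omega>) * ((transpose P *v v) $ i)\<^sup>2)"
proof -
  have "(A + \<omega> *\<^sub>R mat 1) *v v = A *v v + \<omega> *\<^sub>R v"
    by (simp add: matrix_vector_mult_add_rdistrib scaleR_matrix_vector_assoc[symmetric])
  then have "v \<bullet> ((A + \<omega> *\<^sub>R mat 1) *v v) = v \<bullet> (A *v v) + \<omega> * (v \<bullet> v)"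
    by (simp add: inner_add_right)
  also have "\<dots> = (\<Sum>i\<in>UNIV. (d i + \<omega>) * ((transpose P *v v) $ i)\<^sup>2)"
    unfolding inner_orthogonal_coordinates[of v] unfolding inner_vec_def eigencoordinates
    by (simp add: sum_distrib_left sum.distrib[symmetric] algebra_simps power2_eq_square
        del: transpose_matrix_vector)
  finally show ?thesis .
qed

lemma transpose_P_eq_0_iff: "transpose P *v v = 0 \<longleftrightarrow> v = 0"
  using inner_orthogonal_coordinates[of v v] by (metis inner_eq_zero_iff)

text \<open>The projection \<open>f\<close> onto the eigencoordinates with
  \<open>d i < - \<omega>\<close> is injective on \<open>V\<close>: where these coordinates vanish,
  the form is a sum of nonnegative terms. This is one half of Sylvester's law of inertia.\<close>

lemma dim_negative_definite_le:
  assumes "subspace V" and neg: "\<And>v. v \<in> V \<Longrightarrow> v \<noteq> 0 \<Longrightarrow> v \<bullet> ((A + \<omega> *\<^sub>R mat 1) *v v) < 0"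
  shows "dim V \<le> card {i. d i < - \<omega>}"
proof -
  define f where "f v = (\<chi> i. if d i < - \<omega> then (transpose P *v v) $ i else 0)" for v
  have lin: "linear f"
    by (rule linearI) (auto simp: f_def vec_eq_iff matrix_vector_right_distrib matrix_vector_mult_scaleR
        simp del: transpose_matrix_vector)
  have "v = 0" if "v \<in> V" "f v = 0" for v
  proof (rule ccontr)
    assume "v \<noteq> 0"
    have "0 \<le> (\<Sum>i\<in>UNIV. (d i + \<omega>) * ((transpose P *v v) $ i)\<^sup>2)"
    proof (rule sum_nonneg)
      fix i
      have "f v $ i = 0" using that(2) by simp
      then have "d i < - \<omega> \<Longrightarrow> (transpose P *v v) $ i = 0"
        by (simp add: f_def del: transpose_matrix_vector)
      then show "0 \<le> (d i + \<omega>) * ((transpose P *v v) $ i)\<^sup>2"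
        by (cases "d i < - \<omega>") (auto simp del: transpose_matrix_vector)
    qed
    with neg[OF that(1) \<open>v \<noteq> 0\<close>] show False by (simp add: shifted_quadratic_form del: transpose_matrix_vector)
  qed
  then have "inj_on f V"
    using lin \<open>subspace V\<close> by (simp add: linear_inj_on_iff_eq_0)
  then have "dim V = dim (f ` V)"
    using dim_image_eq[OF lin, of V] span_eq_iff[THEN iffD2, OF \<open>subspace V\<close>] by simp
  also have "\<dots> \<le> dim {x :: real ^ 'm. \<forall>i. i \<notin> {i. d i < - \<omega>} \<longrightarrow> x $ i = 0}"
    by (rule dim_subset) (auto simp: f_def)
  also have "\<dots> = card {i. d i < - \<omega>}"
    using dim_substandard_cart[where 'a = real] by (simp only: dim_vec_eq)
  finally show ?thesis .
qed

text \<open>The span of the eigenvectors with eigenvalue below \<open>- \<omega>\<close>, written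
  through the vanishing of the remaining coordinates, so that \<open>transpose P\<close> maps it
  onto a coordinate subspace.\<close>

definition negative_eigenspace :: "real \<Rightarrow> (real ^ 'm) set" where
  "negative_eigenspace \<omega> = {v. \<forall>i. - \<omega> \<le> d i \<longrightarrow> (transpose P *v v) $ i = 0}"

lemma subspace_negative_eigenspace: "subspace (negative_eigenspace \<omega>)"
  by (auto simp: subspace_def negative_eigenspace_def matrix_vector_right_distrib matrix_vector_mult_scaleR
      simp del: transpose_matrix_vector)

lemma dim_negative_eigenspace: "dim (negative_eigenspace \<omega>) = card {i. d i < - \<omega>}"
proof -
  let ?S = "{x :: real ^ 'm. \<forall>i. i \<notin> {i. d i < - \<omega>} \<longrightarrow> x $ i = 0}"
  have PP: "transpose P *v (P *v x) = x" "P *v (transpose P *v x) = x" for x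
    using P(1) by (simp_all add: matrix_vector_mul_assoc orthogonal_matrix_def del: transpose_matrix_vector)
  have "negative_eigenspace \<omega> = (*v) P ` ?S"
  proof (intro set_eqI iffI)
    fix v assume "v \<in> negative_eigenspace \<omega>"
    then have "transpose P *v v \<in> ?S" by (auto simp: negative_eigenspace_def not_less simp del: transpose_matrix_vector)
    then show "v \<in> (*v) P ` ?S" 
      by (intro image_eqI[of _ _ "transpose P *v v"]) (simp_all add: PP del: transpose_matrix_vector)
  next
    fix v assume "v \<in> (*v) P ` ?S"
    then show "v \<in> negative_eigenspace \<omega>"
      by (auto simp: negative_eigenspace_def PP simp del: transpose_matrix_vector)
  qed
  moreover have "inj ((*v) P)" 
    by (rule inj_on_inverseI[of _ "(*v) (transpose P)"]) (simp add: PP del: transpose_matrix_vector)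
  ultimately have "dim (negative_eigenspace \<omega>) = dim ?S"
    by (simp add: dim_image_eq inj_on_subset)
  then show ?thesis using dim_substandard_cart[where 'a = real] by (simp only: dim_vec_eq)
qed

lemma negative_on_negative_eigenspace:
  assumes "v \<in> negative_eigenspace \<omega>" "v \<noteq> 0"
  shows "v \<bullet> ((A + \<omega> *\<^sub>R mat 1) *v v) < 0"
proof -
  have "transpose P *v v \<noteq> 0" using assms(2) transpose_P_eq_0_iff by blast
  then obtain j where j: "(transpose P *v v) $ j \<noteq> 0" by (auto simp: vec_eq_iff simp del: transpose_matrix_vector)
  have "(\<Sum>i\<in>UNIV. (d i + \<omega>) * ((transpose P *v v) $ i)\<^sup>2) < (\<Sum>i\<in>(UNIV :: 'm set). 0)"
  proof (rule sum_strict_mono_ex1)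
    show "\<forall>i\<in>UNIV. (d i + \<omega>) * ((transpose P *v v) $ i)\<^sup>2 \<le> 0"
      using assms(1) by (force simp: negative_eigenspace_def mult_le_0_iff simp del: transpose_matrix_vector)
    have "d j + \<omega> < 0" using assms(1) j by (force simp: negative_eigenspace_def simp del: transpose_matrix_vector)
    then show "\<exists>i\<in>UNIV. (d i + \<omega>) * ((transpose P *v v) $ i)\<^sup>2 < 0"
      using j by (intro bexI[of _ j]) (auto intro: mult_neg_pos simp del: transpose_matrix_vector)
  qed simp
  then show ?thesis by (simp add: shifted_quadratic_form del: transpose_matrix_vector)
qed

text \<open>An eigenvector for \<open>\<kappa>\<close> has zero coordinates wherever
  \<open>d i \<noteq> \<kappa>\<close>, in particular wherever \<open>d i < - \<omega>\<close>; the
  other coordinates of \<open>v\<close> are zero.\<close>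

lemma negative_eigenspace_orthogonal:
  assumes "v \<in> negative_eigenspace \<omega>" "A *v f = \<kappa> *\<^sub>R f" "- \<omega> \<le> \<kappa>"
  shows "v \<bullet> f = 0"
proof -
  have "(transpose P *v v) $ i * (transpose P *v f) $ i = 0" for i
  proof (cases "- \<omega> \<le> d i")
    case True
    then show ?thesis using assms(1) by (simp add: negative_eigenspace_def del: transpose_matrix_vector)
  next
    case False
    have "d i * (transpose P *v f) $ i = \<kappa> * (transpose P *v f) $ i"
      by (simp add: eigencoordinates[symmetric] assms(2) matrix_vector_mult_scaleR del: transpose_matrix_vector)
    with False assms(3) show ?thesis by auto
  qed
  then show ?thesis
    unfolding inner_orthogonal_coordinates[of v] unfolding inner_vec_def inner_real_def
    by (intro sum.neutral) blast
qed

text \<open>After the change of variables \<open>R\<close>, the bound of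
  \<open>dim_negative_definite_le\<close> applies to every admissible \<open>V\<close>. It is
  attained by the preimage of the negative eigenspace under \<open>R\<close>, which the assumption
  on \<open>T\<close> places inside \<open>T\<close> by
  \<open>negative_eigenspace_orthogonal\<close>. In the application \<open>T\<close> is the tangent
  space and \<open>R\<close> the square root of the circulation matrix.\<close>

theorem Max_dim_negative_definite:
  fixes R R' :: "real ^ 'm ^ 'm"
  assumes R: "R' ** R = mat 1"
    and T: "\<And>v. (\<And>f \<kappa>. A *v f = \<kappa> *\<^sub>R f \<Longrightarrow> - \<omega> \<le> \<kappa> \<Longrightarrow> (R *v v) \<bullet> f = 0) \<Longrightarrow> v \<in> T"
  shows "Max {dim V | V. subspace V \<and> V \<subseteq> T \<and>
      (\<forall>v\<in>V. v \<noteq> 0 \<longrightarrow> (R *v v) \<bullet> ((A + \<omega> *\<^sub>R mat 1) *v (R *v v)) < 0)} = card {i. d i < - \<omega>}"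
    (is "Max ?S = _")
proof (rule Max_eqI)
  have RR: "R' *v (R *v x) = x" for x using R by (simp add: matrix_vector_mul_assoc)
  have R0: "R *v x = 0 \<longleftrightarrow> x = 0" for x by (metis RR matrix_vector_mult_0_right)
  have R'R: "R *v (R' *v x) = x" for x
    using R by (simp add: matrix_vector_mul_assoc matrix_left_right_inverse)
  have injR: "inj ((*v) R)" "inj ((*v) R')"
    using inj_on_inverseI[of UNIV "(*v) R'" "(*v) R"] inj_on_inverseI[of UNIV "(*v) R" "(*v) R'"] RR R'R
    by blast+
  show "n \<le> card {i. d i < - \<omega>}" if "n \<in> ?S" for n
  proof -
    from that obtain V where V: "n = dim V" "subspace V"
      "\<forall>v\<in>V. v \<noteq> 0 \<longrightarrow> (R *v v) \<bullet> ((A + \<omega> *\<^sub>R mat 1) *v (R *v v)) < 0"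
      unfolding mem_Collect_eq by (elim exE conjE)
    have "dim ((*v) R ` V) \<le> card {i. d i < - \<omega>}"
      using V R0 by (intro dim_negative_definite_le) (auto intro: linear_subspace_image)
    moreover have "dim ((*v) R ` V) = dim V"
      using injR(1) by (simp add: dim_image_eq inj_on_subset)
    ultimately show ?thesis using V(1) by simp
  qed
  then show "finite ?S" 
    by (intro finite_subset[of ?S "{..card {i. d i < - \<omega>}}"] subsetI) (simp_all only: atMost_iff finite_atMost)
  show "card {i. d i < - \<omega>} \<in> ?S"
  proof -
    let ?V = "(*v) R' ` negative_eigenspace \<omega>"
    have "dim ?V = card {i. d i < - \<omega>}"
      using injR(2) by (simp add: dim_image_eq inj_on_subset dim_negative_eigenspace)
    moreover have "subspace ?V"
      by (intro linear_subspace_image subspace_negative_eigenspace) simp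
    moreover have "?V \<subseteq> T"
      by (auto simp: R'R intro!: T negative_eigenspace_orthogonal)
    moreover have "\<forall>v\<in>?V. v \<noteq> 0 \<longrightarrow> (R *v v) \<bullet> ((A + \<omega> *\<^sub>R mat 1) *v (R *v v)) < 0"
      by (auto simp: R'R intro!: negative_on_negative_eigenspace)
    ultimately show ?thesis
      unfolding mem_Collect_eq by (intro exI[of _ ?V] conjI) (simp_all only:)
  qed
qed

end

section \<open>The Hessian of the Hamiltonian\<close>

lemma pos_linear [simp]:
  "pos (u + v) i = pos u i + pos v i" "pos (u - v) i = pos u i - pos v i" "pos (t *\<^sub>R u) i = t *\<^sub>R pos u i"
  by (simp_all add: pos_def vec_eq_iff)

text \<open>The logarithm of the norm is half the logarithm of a quadratic polynomial in
  \<open>t\<close>, which is nonzero at 0.\<close>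

lemma has_derivative_ln_norm_line:
  fixes p q :: "'a::real_inner"
  assumes "p \<noteq> 0"
  shows "((\<lambda>t. ln (norm (p + t *\<^sub>R q))) has_real_derivative (p \<bullet> q) / (p \<bullet> p)) (at 0)"
proof -
  have "ln (norm (p + t *\<^sub>R q)) = ln (p \<bullet> p + 2 * t * (p \<bullet> q) + t\<^sup>2 * (q \<bullet> q)) / 2" for t
  proof -
    have "(p + t *\<^sub>R q) \<bullet> (p + t *\<^sub>R q) = p \<bullet> p + 2 * t * (p \<bullet> q) + t\<^sup>2 * (q \<bullet> q)"
      by (simp add: inner_simps inner_commute power2_eq_square algebra_simps)
    then show ?thesis by (metis inner_ge_zero ln_sqrt norm_eq_sqrt_inner)
  qed
  note ln_eq = this
  have "((\<lambda>t. ln (p \<bullet> p + 2 * t * (p \<bullet> q) + t\<^sup>2 * (q \<bullet> q)) / 2) has_real_derivative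
      (p \<bullet> q) / (p \<bullet> p)) (at 0)"
    using assms by (auto intro!: derivative_eq_intros simp: divide_simps)
  then show ?thesis by (simp only: ln_eq)
qed

text \<open>The quotient is the derivative of \<open>ln (norm p)\<close> in direction
  \<open>r\<close>, so this computes its second derivative in directions \<open>q\<close> and
  \<open>r\<close>.\<close>

lemma has_derivative_inner_quotient_line:
  fixes p q r :: "'a::real_inner"
  assumes "p \<noteq> 0"
  shows "((\<lambda>t. ((p + t *\<^sub>R q) \<bullet> r) / ((p + t *\<^sub>R q) \<bullet> (p + t *\<^sub>R q))) has_real_derivative
      (q \<bullet> r) / (p \<bullet> p) - 2 * (p \<bullet> q) * (p \<bullet> r) / (p \<bullet> p)\<^sup>2) (at 0)"
proof -
  have "((p + t *\<^sub>R q) \<bullet> r) / ((p + t *\<^sub>R q) \<bullet> (p + t *\<^sub>R q))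
      = (p \<bullet> r + t * (q \<bullet> r)) / (p \<bullet> p + 2 * t * (p \<bullet> q) + t\<^sup>2 * (q \<bullet> q))" for t
    by (simp add: inner_simps inner_commute power2_eq_square algebra_simps)
  moreover have "((\<lambda>t. (p \<bullet> r + t * (q \<bullet> r)) / (p \<bullet> p + 2 * t * (p \<bullet> q) + t\<^sup>2 * (q \<bullet> q)))
      has_real_derivative (q \<bullet> r) / (p \<bullet> p) - 2 * (p \<bullet> q) * (p \<bullet> r) / (p \<bullet> p)\<^sup>2) (at 0)"
    using assms by (auto intro!: derivative_eq_intros simp: divide_simps power2_eq_square)
  ultimately show ?thesis by simp
qed

definition rel_pos :: "real ^ ('n \<times> 2) \<Rightarrow> 'n::finite \<Rightarrow> 'n \<Rightarrow> real ^ 2" where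
  "rel_pos u a b = pos u a - pos u b"

lemma rel_pos_linear [simp]:
  "rel_pos (u + v) a b = rel_pos u a b + rel_pos v a b"
  "rel_pos (t *\<^sub>R u) a b = t *\<^sub>R rel_pos u a b"
  by (simp_all add: rel_pos_def algebra_simps)

definition hamiltonian_gradient_form ::
  "('n::{finite,linorder} \<Rightarrow> real) \<Rightarrow> real ^ ('n \<times> 2) \<Rightarrow> real ^ ('n \<times> 2) \<Rightarrow> real" where
  "hamiltonian_gradient_form \<Gamma> z v = - (\<Sum>(a, b) | a < b. \<Gamma> a * \<Gamma> b *
     ((rel_pos z a b \<bullet> rel_pos v a b) / (rel_pos z a b \<bullet> rel_pos z a b)))"

text \<open>Each summand is the second derivative of \<open>ln (norm p)\<close> at
  \<open>p = rel_pos z a b\<close>, evaluated on the relative displacements of \<open>u\<close> and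
  \<open>v\<close>.\<close>

definition hamiltonian_hessian_form ::
  "('n::{finite,linorder} \<Rightarrow> real) \<Rightarrow> real ^ ('n \<times> 2) \<Rightarrow> real ^ ('n \<times> 2) \<Rightarrow> real ^ ('n \<times> 2) \<Rightarrow> real" where
  "hamiltonian_hessian_form \<Gamma> z u v = - (\<Sum>(a, b) | a < b. \<Gamma> a * \<Gamma> b *
     ((rel_pos u a b \<bullet> rel_pos v a b) / (rel_pos z a b \<bullet> rel_pos z a b)
      - 2 * (rel_pos z a b \<bullet> rel_pos u a b) * (rel_pos z a b \<bullet> rel_pos v a b)
        / (rel_pos z a b \<bullet> rel_pos z a b)\<^sup>2))"

lemma rel_pos_eq_0: "inj (pos z) \<Longrightarrow> a \<noteq> b \<Longrightarrow> rel_pos z a b \<noteq> 0"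
  by (auto simp: rel_pos_def inj_eq)

lemma has_derivative_hamiltonian_line:
  assumes "inj (pos z)"
  shows "((\<lambda>t. hamiltonian \<Gamma> (z + t *\<^sub>R v)) has_real_derivative hamiltonian_gradient_form \<Gamma> z v) (at 0)"
  unfolding hamiltonian_def hamiltonian_gradient_form_def case_prod_unfold dist_norm rel_pos_def[symmetric] rel_pos_linear
  using rel_pos_eq_0[OF assms]
  by (intro DERIV_minus DERIV_sum DERIV_cmult has_derivative_ln_norm_line) auto

lemma has_derivative_hamiltonian_gradient_form_line:
  assumes "inj (pos z)"
  shows "((\<lambda>t. hamiltonian_gradient_form \<Gamma> (z + t *\<^sub>R u) v) has_real_derivative
      hamiltonian_hessian_form \<Gamma> z u v) (at 0)"
  unfolding hamiltonian_gradient_form_def hamiltonian_hessian_form_def case_prod_unfold rel_pos_linear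
  using rel_pos_eq_0[OF assms]
  by (intro DERIV_minus DERIV_sum DERIV_cmult has_derivative_inner_quotient_line) auto

text \<open>A second partial derivative needs the gradient formula at all points near
  \<open>z\<close> on a line. Being free of collisions is a finite conjunction of open conditions on
  \<open>t\<close>, so it persists for small \<open>t\<close>.\<close>

lemma eventually_inj_pos_line:
  assumes "inj (pos z)"
  shows "\<forall>\<^sub>F t in nhds (0::real). inj (pos (z + t *\<^sub>R u))"
proof -
  have "\<forall>\<^sub>F t in nhds (0::real). a \<noteq> b \<longrightarrow> pos z a + t *\<^sub>R pos u a \<noteq> pos z b + t *\<^sub>R pos u b" for a b
  proof (cases "a = b")
    case False
    have "open {t::real. pos z a + t *\<^sub>R pos u a \<noteq> pos z b + t *\<^sub>R pos u b}"
      by (intro open_Collect_neq continuous_intros)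
    moreover have "pos z a \<noteq> pos z b" using assms False by (simp add: inj_eq)
    ultimately show ?thesis unfolding eventually_nhds by (intro exI conjI) auto
  qed simp
  then have "\<forall>\<^sub>F t in nhds (0::real). \<forall>a b. a \<noteq> b \<longrightarrow> pos z a + t *\<^sub>R pos u a \<noteq> pos z b + t *\<^sub>R pos u b"
    by (intro eventually_all_finite)
  then show ?thesis by (rule eventually_mono) (auto simp: inj_def)
qed

lemma hessian_hamiltonian_component:
  assumes "inj (pos z)"
  shows "hessian (hamiltonian \<Gamma>) z $ p $ q = hamiltonian_hessian_form \<Gamma> z (axis p 1) (axis q 1)"
proof -
  have "\<forall>\<^sub>F t in nhds 0. partial_deriv q (hamiltonian \<Gamma>) (z + t *\<^sub>R axis p 1)
      = hamiltonian_gradient_form \<Gamma> (z + t *\<^sub>R axis p 1) (axis q 1)"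
    using eventually_inj_pos_line[OF assms, of "axis p 1"]
    by (rule eventually_mono) (simp add: partial_deriv_def DERIV_imp_deriv has_derivative_hamiltonian_line)
  then have "deriv (\<lambda>t. partial_deriv q (hamiltonian \<Gamma>) (z + t *\<^sub>R axis p 1)) 0
      = deriv (\<lambda>t. hamiltonian_gradient_form \<Gamma> (z + t *\<^sub>R axis p 1) (axis q 1)) 0"
    by (rule deriv_cong_ev) simp
  also have "\<dots> = hamiltonian_hessian_form \<Gamma> z (axis p 1) (axis q 1)"
    by (intro DERIV_imp_deriv has_derivative_hamiltonian_gradient_form_line assms)
  finally show ?thesis by (simp add: hessian_def partial_deriv_def[of p])
qed

lemma hamiltonian_hessian_form_commute:
  "hamiltonian_hessian_form \<Gamma> z u v = hamiltonian_hessian_form \<Gamma> z v u"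
  by (simp add: hamiltonian_hessian_form_def inner_commute mult.commute mult.left_commute)

lemma linear_hamiltonian_hessian_form: "linear (hamiltonian_hessian_form \<Gamma> z u)"
proof (rule linearI)
  show "hamiltonian_hessian_form \<Gamma> z u (v + w) = hamiltonian_hessian_form \<Gamma> z u v + hamiltonian_hessian_form \<Gamma> z u w"
    for v w
    unfolding hamiltonian_hessian_form_def minus_add_distrib[symmetric] sum.distrib[symmetric]
    by (intro arg_cong[of _ _ uminus] sum.cong) (auto simp: inner_simps add_divide_distrib algebra_simps)
  show "hamiltonian_hessian_form \<Gamma> z u (c *\<^sub>R v) = c *\<^sub>R hamiltonian_hessian_form \<Gamma> z u v" for c v
    unfolding hamiltonian_hessian_form_def real_scaleR_def mult_minus_right sum_distrib_left
    by (intro arg_cong[of _ _ uminus] sum.cong) (auto simp: algebra_simps)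
qed

lemma linear_eq_sum_axis:
  fixes f :: "real ^ 'm::finite \<Rightarrow> real"
  assumes "linear f"
  shows "f v = (\<Sum>q\<in>UNIV. v $ q * f (axis q 1))"
proof -
  have "v = (\<Sum>q\<in>UNIV. v $ q *\<^sub>R axis q 1)"
    using basis_expansion[of v] by (simp add: scalar_mult_eq_scaleR)
  then have "f v = f (\<Sum>q\<in>UNIV. v $ q *\<^sub>R axis q 1)" by simp
  also have "\<dots> = (\<Sum>q\<in>UNIV. v $ q * f (axis q 1))"
    by (simp add: linear_sum[OF assms] linear_cmul[OF assms])
  finally show ?thesis .
qed

text \<open>Bilinearity extends the entrywise formula to all vectors. Identities for the Hessian
  matrix are then obtained from the explicit form by testing against every \<open>u\<close>.\<close>

theorem inner_hessian_hamiltonian: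
  assumes "inj (pos z)"
  shows "u \<bullet> (hessian (hamiltonian \<Gamma>) z *v v) = hamiltonian_hessian_form \<Gamma> z u v"
proof -
  have "hamiltonian_hessian_form \<Gamma> z u v = (\<Sum>p\<in>UNIV. u $ p * hamiltonian_hessian_form \<Gamma> z v (axis p 1))"
    by (subst hamiltonian_hessian_form_commute) (rule linear_eq_sum_axis[OF linear_hamiltonian_hessian_form])
  also have "\<dots> = (\<Sum>p\<in>UNIV. u $ p * (\<Sum>q\<in>UNIV. v $ q * hamiltonian_hessian_form \<Gamma> z (axis p 1) (axis q 1)))"
    by (simp add: hamiltonian_hessian_form_commute[of _ _ v] linear_eq_sum_axis[OF linear_hamiltonian_hessian_form, of _ _ _ v])
  also have "\<dots> = u \<bullet> (hessian (hamiltonian \<Gamma>) z *v v)"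
    by (simp add: inner_vec_def matrix_vector_mult_def hessian_hamiltonian_component[OF assms] mult.commute)
  finally show ?thesis by simp
qed

section \<open>Relative equilibria\<close>

lemma pos_eqI: "(\<And>i. pos u i = pos v i) \<Longrightarrow> u = v"
  by (simp add: pos_def vec_eq_iff)

lemma inner_eq_sum_pos: "u \<bullet> v = (\<Sum>i\<in>UNIV. pos u i \<bullet> pos v i)"
  by (simp add: inner_vec_def pos_def sum.cartesian_product UNIV_Times_UNIV[symmetric] del: UNIV_Times_UNIV)

section \<open>Weights per vortex and the simultaneous quarter turn\<close>

lemma circulation_matrix_vector: "(circulation_matrix f *v v) $ p = f (fst p) * v $ p"
  by (simp add: circulation_matrix_def matrix_vector_mult_def if_distrib[of "\<lambda>x. x * _"] cong: if_cong)

lemma pos_circulation_matrix [simp]: "pos (circulation_matrix f *v v) i = f i *\<^sub>R pos v i"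
  by (simp add: pos_def vec_eq_iff circulation_matrix_vector)

lemma inner_circulation_matrix: "u \<bullet> (circulation_matrix f *v v) = (\<Sum>i\<in>UNIV. f i * (pos u i \<bullet> pos v i))"
  by (simp add: inner_eq_sum_pos)

lemma circulation_matrix_mult:
  "circulation_matrix f ** circulation_matrix g = circulation_matrix (\<lambda>i. f i * g i)"
  by (simp add: matrix_eq matrix_vector_mul_assoc[symmetric] vec_eq_iff circulation_matrix_vector)

lemma circulation_matrix_1: "circulation_matrix (\<lambda>i. 1) = mat 1"
  by (simp add: matrix_eq vec_eq_iff circulation_matrix_vector)

lemma transpose_circulation_matrix: "transpose (circulation_matrix f) = circulation_matrix f"
  by (auto simp: transpose_def circulation_matrix_def vec_eq_iff)

lemma J_mat_vector: "J_mat *v x = vector [x $ 2, - x $ 1]"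
  by (simp add: J_mat_def vec_eq_iff forall_2 matrix_vector_mult_def sum_2)

lemma pos_K_mat: "pos (K_mat *v u) i = J_mat *v pos u i"
proof -
  have "(\<Sum>q\<in>UNIV. K_mat $ (i, k) $ q * u $ q) = (\<Sum>l\<in>UNIV. J_mat $ k $ l * u $ (i, l))" for k
  proof -
    have "(\<Sum>q\<in>UNIV. K_mat $ (i, k) $ q * u $ q) = (\<Sum>j\<in>UNIV. \<Sum>l\<in>UNIV. K_mat $ (i, k) $ (j, l) * u $ (j, l))"
      by (simp add: sum.cartesian_product UNIV_Times_UNIV[symmetric] del: UNIV_Times_UNIV)
    also have "\<dots> = (\<Sum>j\<in>UNIV. if i = j then (\<Sum>l\<in>UNIV. J_mat $ k $ l * u $ (j, l)) else 0)"
      by (intro sum.cong) (auto simp: K_mat_def)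
    finally show ?thesis by simp
  qed
  then show ?thesis by (simp add: pos_def vec_eq_iff matrix_vector_mult_def)
qed

lemma rel_pos_K_mat [simp]: "rel_pos (K_mat *v u) a b = J_mat *v rel_pos u a b"
  by (simp add: rel_pos_def pos_K_mat matrix_vector_mult_diff_distrib)

lemma K_mat_square: "K_mat ** K_mat = - (mat 1 :: real ^ ('n::finite \<times> 2) ^ ('n \<times> 2))"
proof -
  have "K_mat *v (K_mat *v u) = - u" for u :: "real ^ ('n \<times> 2)"
  proof (rule pos_eqI)
    fix i
    show "pos (K_mat *v (K_mat *v u)) i = pos (- u) i"
      by (simp add: pos_K_mat J_mat_vector) (simp add: pos_def vec_eq_iff forall_2)
  qed
  then have "(K_mat ** K_mat + mat 1) *v u = 0 *v u" for u :: "real ^ ('n \<times> 2)"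
    by (simp add: matrix_vector_mult_add_rdistrib matrix_vector_mul_assoc[symmetric])
  then have "K_mat ** K_mat + mat 1 = (0 :: real ^ ('n \<times> 2) ^ ('n \<times> 2))"
    by (subst matrix_eq) blast
  then show ?thesis by (simp add: eq_neg_iff_add_eq_0)
qed

lemma transpose_K_mat: "transpose K_mat = - (K_mat :: real ^ ('n::finite \<times> 2) ^ ('n \<times> 2))"
proof -
  have "J_mat $ k $ l = - J_mat $ l $ k" for k l
    using exhaust_2[of k] exhaust_2[of l] by (auto simp: J_mat_def)
  note J = this
  have "transpose K_mat $ p $ q = - (K_mat $ p $ q)" for p q :: "'n \<times> 2"
    by (simp add: transpose_def K_mat_def J[of "snd q" "snd p"])
  then show ?thesis by (simp add: vec_eq_iff)
qed

text \<open>Both coordinates of a vortex carry the same weight, so the diagonal matrix acts as a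
  scalar on each plane that \<open>K_mat\<close> rotates.\<close>

lemma K_mat_circulation_matrix: "K_mat ** circulation_matrix f = circulation_matrix f ** K_mat"
  unfolding matrix_eq matrix_vector_mul_assoc[symmetric]
  by (intro allI pos_eqI) (simp add: pos_K_mat matrix_vector_mult_scaleR)

text \<open>
  The Hessian of \<open>ln \<parallel>p\<parallel>\<close> is a multiple of a reflection of the plane, and a reflection
  anticommutes with the quarter turn \<open>J\<close>.
\<close>

lemma J_mat_reflection:
  "(u \<bullet> (J_mat *v v)) / (p \<bullet> p) - 2 * (p \<bullet> u) * (p \<bullet> (J_mat *v v)) / (p \<bullet> p)\<^sup>2
   = ((J_mat *v u) \<bullet> v) / (p \<bullet> p) - 2 * (p \<bullet> (J_mat *v u)) * (p \<bullet> v) / (p \<bullet> p)\<^sup>2"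
\<comment> \<open>Away from 0, clearing denominators leaves a polynomial identity in the
  coordinates. At \<open>p = 0\<close> both sides are 0 since division by zero yields 0.\<close>
proof (cases "p = 0")
  case False
  have "(p \<bullet> p) * (u \<bullet> (J_mat *v v)) - 2 * (p \<bullet> u) * (p \<bullet> (J_mat *v v))
    = (p \<bullet> p) * ((J_mat *v u) \<bullet> v) - 2 * (p \<bullet> (J_mat *v u)) * (p \<bullet> v)"
    by (simp add: J_mat_vector inner_vec_def sum_2 algebra_simps)
  then have "((p \<bullet> p) * (u \<bullet> (J_mat *v v)) - 2 * (p \<bullet> u) * (p \<bullet> (J_mat *v v))) / (p \<bullet> p)\<^sup>2
    = ((p \<bullet> p) * ((J_mat *v u) \<bullet> v) - 2 * (p \<bullet> (J_mat *v u)) * (p \<bullet> v)) / (p \<bullet> p)\<^sup>2" by simp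
  with False show ?thesis by (simp add: diff_divide_distrib power2_eq_square)
qed simp

lemma hamiltonian_hessian_form_K_mat:
  "hamiltonian_hessian_form \<Gamma> z u (K_mat *v v) = hamiltonian_hessian_form \<Gamma> z (K_mat *v u) v"
  unfolding hamiltonian_hessian_form_def rel_pos_K_mat J_mat_reflection ..

text \<open>Moving \<open>K_mat\<close> to the other side of the inner product costs a sign, because
  it is skew; moving it between the two arguments of the Hessian form costs none.\<close>

lemma K_mat_hessian_anticommute:
  fixes z :: "real ^ ('n::{finite,linorder} \<times> 2)"
  assumes "inj (pos z)"
  shows "K_mat ** hessian (hamiltonian \<Gamma>) z = - (hessian (hamiltonian \<Gamma>) z ** K_mat)"
proof -
  let ?H = "hessian (hamiltonian \<Gamma>) z"
  have "u \<bullet> ((K_mat ** ?H) *v v) = u \<bullet> ((- (?H ** K_mat)) *v v)" for u v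
  proof -
    have neg: "(- X) *v v = - (X *v v)" for X :: "real ^ ('n \<times> 2) ^ ('n \<times> 2)" and v
      by (simp add: matrix_vector_mult_def vec_eq_iff sum_negf)
    have "u \<bullet> ((K_mat ** ?H) *v v) = (transpose K_mat *v u) \<bullet> (?H *v v)"
      by (simp add: matrix_vector_mul_assoc[symmetric] inner_matrix_vector_transpose del: transpose_matrix_vector)
    also have "\<dots> = - ((K_mat *v u) \<bullet> (?H *v v))"
      by (simp add: transpose_K_mat neg del: transpose_matrix_vector)
    also have "\<dots> = - hamiltonian_hessian_form \<Gamma> z (K_mat *v u) v"
      by (simp only: inner_hessian_hamiltonian[OF assms])
    also have "\<dots> = u \<bullet> ((- (?H ** K_mat)) *v v)"
      by (simp add: neg matrix_vector_mul_assoc[symmetric] inner_hessian_hamiltonian[OF assms]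
          hamiltonian_hessian_form_K_mat)
    finally show ?thesis .
  qed
  then show ?thesis unfolding matrix_eq using vector_eq_ldot by blast
qed

lemma transpose_hessian_hamiltonian:
  assumes "inj (pos z)"
  shows "transpose (hessian (hamiltonian \<Gamma>) z) = hessian (hamiltonian \<Gamma>) z"
  by (simp add: transpose_def vec_eq_iff hessian_hamiltonian_component[OF assms]
      hamiltonian_hessian_form_commute[of _ _ "axis _ 1" "axis _ 1"])

section \<open>Translations and dilations as eigendirections of the Hessian\<close>

definition constant_config :: "real ^ 2 \<Rightarrow> real ^ ('n::finite \<times> 2)" where
  "constant_config x = (\<chi> p. x $ snd p)"

lemma pos_constant_config [simp]: "pos (constant_config x) i = x"
  by (simp add: pos_def constant_config_def)

text \<open>Constant configurations are the directions of translation; they have zero relative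
  positions, and the form depends on relative positions alone.\<close>

lemma hessian_hamiltonian_constant_config:
  assumes "inj (pos z)"
  shows "hessian (hamiltonian \<Gamma>) z *v constant_config x = 0"
proof -
  have "u \<bullet> (hessian (hamiltonian \<Gamma>) z *v constant_config x) = u \<bullet> 0" for u
    by (simp add: inner_hessian_hamiltonian[OF assms] hamiltonian_hessian_form_def case_prod_unfold
        rel_pos_def[of "constant_config x"])
  then show ?thesis using vector_eq_ldot by blast
qed

lemma sum_off_diagonal:
  fixes f :: "'n::{finite,linorder} \<Rightarrow> 'n \<Rightarrow> real"
  shows "(\<Sum>i\<in>UNIV. \<Sum>j\<in>UNIV - {i}. f i j) = (\<Sum>(a, b) | a < b. f a b + f b a)"
proof -
  have "(\<Sum>i\<in>UNIV. \<Sum>j\<in>UNIV - {i}. f i j) = (\<Sum>(a, b)\<in>Sigma UNIV (\<lambda>i. UNIV - {i}). f a b)"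
    by (simp add: sum.Sigma)
  also have "Sigma UNIV (\<lambda>i. UNIV - {i}) = {(a, b). a < b} \<union> {(a, b). b < (a::'n)}"
    by auto
  also have "(\<Sum>(a, b)\<in>\<dots>. f a b) = (\<Sum>(a, b) | a < b. f a b) + (\<Sum>(a, b) | b < a. f a b)"
    by (intro sum.union_disjoint) auto
  also have "(\<Sum>(a, b) | b < a. f a b) = (\<Sum>(a, b) | a < b. f b a)"
    by (rule sum.reindex_bij_witness[where i = prod.swap and j = prod.swap]) auto
  finally show ?thesis by (simp add: sum.distrib[symmetric] case_prod_unfold)
qed

text \<open>The equilibrium equations are paired with a test configuration \<open>u\<close> and
  summed over all vortices. The interaction is antisymmetric, so the ordered pairs
  \<open>(a, b)\<close> and \<open>(b, a)\<close> combine into a single term in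
  \<open>rel_pos u a b\<close>.\<close>

lemma relative_equilibrium_weak_form:
  fixes \<Gamma> :: "'n::{finite,linorder} \<Rightarrow> real"
  assumes "relative_equilibrium \<Gamma> \<omega> z"
  shows "(\<Sum>(a, b) | a < b. \<Gamma> a * \<Gamma> b * ((rel_pos z a b \<bullet> rel_pos u a b) / (rel_pos z a b \<bullet> rel_pos z a b)))
    = \<omega> * (\<Sum>i\<in>UNIV. \<Gamma> i * ((pos z i - vorticity_center \<Gamma> z) \<bullet> pos u i))"
proof -
  define w where "w i j = \<Gamma> i * \<Gamma> j / (rel_pos z i j \<bullet> rel_pos z i j)" for i j
  have eq: "(\<Sum>j\<in>UNIV - {i}. w i j *\<^sub>R rel_pos z j i) + (\<omega> * \<Gamma> i) *\<^sub>R (pos z i - vorticity_center \<Gamma> z) = 0" for i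
    using assms by (simp add: relative_equilibrium_def w_def rel_pos_def dist_norm power2_norm_eq_inner)
  have "0 = (\<Sum>i\<in>UNIV. ((\<Sum>j\<in>UNIV - {i}. w i j *\<^sub>R rel_pos z j i)
      + (\<omega> * \<Gamma> i) *\<^sub>R (pos z i - vorticity_center \<Gamma> z)) \<bullet> pos u i)"
    by (simp add: eq)
  also have "\<dots> = (\<Sum>i\<in>UNIV. \<Sum>j\<in>UNIV - {i}. w i j * (rel_pos z j i \<bullet> pos u i))
      + \<omega> * (\<Sum>i\<in>UNIV. \<Gamma> i * ((pos z i - vorticity_center \<Gamma> z) \<bullet> pos u i))"
    by (simp add: inner_add_left inner_sum_left sum.distrib sum_distrib_left mult.assoc)
  also have "(\<Sum>i\<in>UNIV. \<Sum>j\<in>UNIV - {i}. w i j * (rel_pos z j i \<bullet> pos u i))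
      = (\<Sum>(a, b) | a < b. w a b * (rel_pos z b a \<bullet> pos u a) + w b a * (rel_pos z a b \<bullet> pos u b))"
    by (rule sum_off_diagonal)
  also have "\<dots> = - (\<Sum>(a, b) | a < b. \<Gamma> a * \<Gamma> b * ((rel_pos z a b \<bullet> rel_pos u a b) / (rel_pos z a b \<bullet> rel_pos z a b)))"
  proof -
    have "w a b * (rel_pos z b a \<bullet> pos u a) + w b a * (rel_pos z a b \<bullet> pos u b)
      = - (\<Gamma> a * \<Gamma> b * ((rel_pos z a b \<bullet> rel_pos u a b) / (rel_pos z a b \<bullet> rel_pos z a b)))" for a b
    proof -
      have r: "rel_pos z b a = - rel_pos z a b" by (simp add: rel_pos_def)
      then have "w b a = w a b" by (simp add: w_def mult.commute)
      then have "w a b * (rel_pos z b a \<bullet> pos u a) + w b a * (rel_pos z a b \<bullet> pos u b)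
        = - (w a b * (rel_pos z a b \<bullet> rel_pos u a b))"
        by (simp add: r rel_pos_def[of u] inner_diff_right algebra_simps)
      then show ?thesis by (simp add: w_def)
    qed
    then show ?thesis by (simp add: sum_negf[symmetric] case_prod_unfold)
  qed
  finally show ?thesis by simp
qed

text \<open>Euler's identity for the gradient, which is homogeneous of degree -1: since
  \<open>y\<close> and \<open>z\<close> have the same relative positions, the two terms of each
  summand of the Hessian form merge into minus the first, and what is left is the weak form of the
  equilibrium equations.\<close>

lemma hessian_hamiltonian_dilation:
  fixes \<Gamma> :: "'n::{finite,linorder} \<Rightarrow> real"
  assumes "relative_equilibrium \<Gamma> \<omega> z"
  defines "y \<equiv> z - constant_config (vorticity_center \<Gamma> z)"
  shows "hessian (hamiltonian \<Gamma>) z *v y = \<omega> *\<^sub>R (circulation_matrix \<Gamma> *v y)"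
proof -
  have inj: "inj (pos z)" using assms(1) by (simp add: relative_equilibrium_def)
  have "u \<bullet> (hessian (hamiltonian \<Gamma>) z *v y) = u \<bullet> (\<omega> *\<^sub>R (circulation_matrix \<Gamma> *v y))" for u
  proof -
    have y: "rel_pos y a b = rel_pos z a b" for a b by (simp add: y_def rel_pos_def)
    have "u \<bullet> (hessian (hamiltonian \<Gamma>) z *v y) = hamiltonian_hessian_form \<Gamma> z u y"
      by (rule inner_hessian_hamiltonian[OF inj])
    also have "\<dots> = (\<Sum>(a, b) | a < b. \<Gamma> a * \<Gamma> b * ((rel_pos z a b \<bullet> rel_pos u a b) / (rel_pos z a b \<bullet> rel_pos z a b)))"
      unfolding hamiltonian_hessian_form_def y sum_negf[symmetric]
      by (intro sum.cong) (auto simp: inner_commute[of "rel_pos u _ _"] power2_eq_square)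
    also have "\<dots> = u \<bullet> (\<omega> *\<^sub>R (circulation_matrix \<Gamma> *v y))"
      unfolding relative_equilibrium_weak_form[OF assms(1)]
      by (simp add: inner_circulation_matrix y_def inner_commute)
    finally show ?thesis .
  qed
  then show ?thesis using vector_eq_ldot by blast
qed

text \<open>Testing the weak form with \<open>z\<close> minus its center makes every quotient equal
  to 1, so the product is the sum of \<open>\<Gamma> a * \<Gamma> b\<close> over
  \<open>a < b\<close>. Two distinct vortices make this sum nonempty.\<close>

lemma angular_velocity_times_impulse_pos:
  fixes \<Gamma> :: "'n::{finite,linorder} \<Rightarrow> real"
  assumes "\<And>i. \<Gamma> i > 0" and "relative_equilibrium \<Gamma> \<omega> z" and "(i :: 'n) \<noteq> j"
  shows "\<omega> * angular_impulse \<Gamma> z > 0"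
proof -
  have inj: "inj (pos z)" using assms(2) by (simp add: relative_equilibrium_def)
  have "0 < (\<Sum>(a, b) | a < b. \<Gamma> a * \<Gamma> b)"
  proof (rule sum_pos)
    show "{(a, b). a < (b::'n)} \<noteq> {}" using assms(3) by (cases i j rule: linorder_cases) auto
  qed (use assms(1) in auto)
  also have "\<dots> = (\<Sum>(a, b) | a < b. \<Gamma> a * \<Gamma> b * ((rel_pos z a b \<bullet> rel_pos z a b) / (rel_pos z a b \<bullet> rel_pos z a b)))"
    using rel_pos_eq_0[OF inj] by (intro sum.cong) auto
  also have "\<dots> = (\<Sum>(a, b) | a < b. \<Gamma> a * \<Gamma> b * ((rel_pos z a b \<bullet> rel_pos (z - constant_config (vorticity_center \<Gamma> z)) a b) / (rel_pos z a b \<bullet> rel_pos z a b)))"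
    by (simp add: rel_pos_def)
  also have "\<dots> = \<omega> * angular_impulse \<Gamma> z"
    unfolding relative_equilibrium_weak_form[OF assms(2)]
    by (simp add: angular_impulse_def power2_norm_eq_inner)
  finally show ?thesis .
qed

section \<open>Tangent vectors of the constraint set\<close>

lemma sum_circulation_centered:
  assumes "(\<Sum>i\<in>UNIV. \<Gamma> i) \<noteq> 0"
  shows "(\<Sum>i\<in>UNIV. \<Gamma> i *\<^sub>R (pos z i - vorticity_center \<Gamma> z)) = 0"
  using assms by (simp add: scaleR_diff_right sum_subtractf scaleR_sum_left[symmetric]
      sum_divide_distrib[symmetric] vorticity_center_def)

text \<open>
  The curve runs along the ellipse \<open>c + cos (a t) (z - c) + (sin (a t) / a) v\<close>, where \<open>a\<close> is
  chosen so that \<open>v / a\<close> has the same impulse as \<open>z - c\<close>.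
\<close>

lemma tangent_space_constraint_setI:
  fixes \<Gamma> :: "'n::finite \<Rightarrow> real"
  assumes \<Gamma>: "\<And>i. \<Gamma> i > 0" and I: "angular_impulse \<Gamma> z > 0"
    and v0: "(\<Sum>i\<in>UNIV. \<Gamma> i *\<^sub>R pos v i) = 0"
    and vz: "(\<Sum>i\<in>UNIV. \<Gamma> i * ((pos z i - vorticity_center \<Gamma> z) \<bullet> pos v i)) = 0"
  shows "v \<in> tangent_space (constraint_set \<Gamma> z) z"
proof (cases "v = 0")
  \<comment> \<open>For \<open>v = 0\<close> the frequency \<open>a\<close> defined in the other
    case would be 0; the constant curve serves instead.\<close>
  case True
  then show ?thesis unfolding tangent_space_def
    by (auto intro!: exI[of _ "\<lambda>t. z"] exI[of _ 1] simp: constraint_set_def)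
next
  case False
  define c where "c = vorticity_center \<Gamma> z"
  define y where "y = z - constant_config c"
  define Q where "Q = (\<Sum>i\<in>UNIV. \<Gamma> i * (pos v i \<bullet> pos v i))"
  define a where "a = sqrt (Q / angular_impulse \<Gamma> z)"
  define \<gamma> where "\<gamma> t = constant_config c + (cos (a * t) *\<^sub>R y + (sin (a * t) / a) *\<^sub>R v)" for t
  have \<Gamma>0: "(\<Sum>i\<in>UNIV. \<Gamma> i) > 0" using \<Gamma> by (intro sum_pos) auto
  have y0: "(\<Sum>i\<in>UNIV. \<Gamma> i *\<^sub>R pos y i) = 0"
    using sum_circulation_centered[of \<Gamma> z] \<Gamma>0 by (simp add: y_def c_def)
  have yy: "(\<Sum>i\<in>UNIV. \<Gamma> i * (pos y i \<bullet> pos y i)) = angular_impulse \<Gamma> z"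
    by (simp add: angular_impulse_def y_def c_def power2_norm_eq_inner)
  have yv: "(\<Sum>i\<in>UNIV. \<Gamma> i * (pos y i \<bullet> pos v i)) = 0"
    using vz by (simp add: y_def c_def)
  obtain i where "pos v i \<noteq> 0"
    using False pos_eqI[of v 0] by (auto simp: pos_def zero_vec_def)
  then have "Q > 0"
    unfolding Q_def using \<Gamma> by (intro sum_pos2[of _ i]) (auto simp: less_imp_le)
  then have a: "a > 0" "a\<^sup>2 = Q / angular_impulse \<Gamma> z" using I by (auto simp: a_def)
  have center: "vorticity_center \<Gamma> (\<gamma> t) = c" for t
  proof -
    have "(\<Sum>i\<in>UNIV. \<Gamma> i *\<^sub>R pos (\<gamma> t) i) = (\<Sum>i\<in>UNIV. \<Gamma> i) *\<^sub>R c
        + cos (a * t) *\<^sub>R (\<Sum>i\<in>UNIV. \<Gamma> i *\<^sub>R pos y i) + (sin (a * t) / a) *\<^sub>R (\<Sum>i\<in>UNIV. \<Gamma> i *\<^sub>R pos v i)"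
      by (simp add: \<gamma>_def scaleR_add_right sum.distrib scaleR_sum_left scaleR_sum_right mult.commute)
    then show ?thesis using \<Gamma>0 by (simp add: y0 v0 vorticity_center_def)
  qed
  have impulse: "angular_impulse \<Gamma> (\<gamma> t) = angular_impulse \<Gamma> z" for t
  proof -
    define C S where "C = cos (a * t)" and "S = sin (a * t) / a"
    have "angular_impulse \<Gamma> (\<gamma> t) = (\<Sum>i\<in>UNIV. \<Gamma> i * ((C *\<^sub>R pos y i + S *\<^sub>R pos v i) \<bullet> (C *\<^sub>R pos y i + S *\<^sub>R pos v i)))"
      unfolding angular_impulse_def center power2_norm_eq_inner by (simp add: \<gamma>_def C_def S_def)
    also have "\<dots> = C\<^sup>2 * (\<Sum>i\<in>UNIV. \<Gamma> i * (pos y i \<bullet> pos y i)) + 2 * C * S * (\<Sum>i\<in>UNIV. \<Gamma> i * (pos y i \<bullet> pos v i))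
        + S\<^sup>2 * (\<Sum>i\<in>UNIV. \<Gamma> i * (pos v i \<bullet> pos v i))"
      unfolding sum_distrib_left sum.distrib[symmetric]
      by (intro sum.cong) (simp_all add: inner_simps inner_commute[of "pos v _" "pos y _"] power2_eq_square algebra_simps)
    also have "\<dots> = C\<^sup>2 * angular_impulse \<Gamma> z + S\<^sup>2 * Q"
      by (simp add: yy yv Q_def)
    also have "S\<^sup>2 * Q = (sin (a * t))\<^sup>2 * angular_impulse \<Gamma> z"
      using a I \<open>Q > 0\<close> by (simp add: S_def power_divide)
    finally show ?thesis by (simp add: C_def distrib_right[symmetric])
  qed
  have "\<gamma> ` {- 1<..<1} \<subseteq> constraint_set \<Gamma> z"
    using center impulse by (auto simp: constraint_set_def c_def)
  moreover have "\<gamma> 0 = z" by (simp add: \<gamma>_def y_def)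
  moreover have "(\<gamma> has_vector_derivative v) (at 0)"
  proof -
    have "((\<lambda>t. cos (a * t)) has_field_derivative 0) (at 0)" "((\<lambda>t. sin (a * t) / a) has_field_derivative 1) (at 0)"
      using a(1) by (auto intro!: derivative_eq_intros)
    then have "(\<gamma> has_vector_derivative 0 + ((cos (a * 0) *\<^sub>R 0 + 0 *\<^sub>R y) + ((sin (a * 0) / a) *\<^sub>R 0 + 1 *\<^sub>R v))) (at 0)"
      unfolding \<gamma>_def
      by (intro has_vector_derivative_add has_vector_derivative_scaleR has_vector_derivative_const)
    then show ?thesis by simp
  qed
  ultimately show ?thesis
    unfolding tangent_space_def mem_Collect_eq by (intro exI[of _ \<gamma>] exI[of _ 1]) simp
qed

text \<open>A curve in a single point is constant near 0 and has velocity 0. This serves the case of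
  one vortex.\<close>

lemma tangent_space_singleton: "tangent_space {z} z = {0}"
proof (intro equalityI subsetI)
  fix v assume "v \<in> tangent_space {z} z"
  then obtain \<gamma> \<epsilon> where \<epsilon>: "0 < \<epsilon>" and const: "\<gamma> ` {- \<epsilon><..<\<epsilon>} \<subseteq> {z}"
    and v: "(\<gamma> has_vector_derivative v) (at (0::real))" by (auto simp: tangent_space_def)
  have "(\<gamma> has_vector_derivative 0) (at 0)"
    by (rule has_vector_derivative_transform_within_open[of "\<lambda>t. z" _ _ "{- \<epsilon><..<\<epsilon>}"])
      (use \<epsilon> const in \<open>auto simp: image_subset_iff\<close>)
  then show "v \<in> {0}" using v vector_derivative_unique_at by auto
next
  fix v :: 'a assume "v \<in> {0}"
  then show "v \<in> tangent_space {z} z" unfolding tangent_space_def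
    by (auto intro!: exI[of _ "\<lambda>t. z"] exI[of _ 1])
qed

theorem theorem3p5:
  fixes \<Gamma> :: "'n::{finite,linorder} \<Rightarrow> real"
    and \<omega> :: real
    and z :: "real ^ ('n \<times> 2)"
  assumes "\<And>i. \<Gamma> i > 0"
    and "relative_equilibrium \<Gamma> \<omega> z"
  shows "morse_index \<Gamma> \<omega> z = num_real_eigenvalue_pairs (stability_matrix \<Gamma> \<omega> z)"
proof -
  define H where "H = hessian (hamiltonian \<Gamma>) z"
  define M where "M = circulation_matrix \<Gamma>"
  \<comment> \<open>\<open>R\<close> is the square root of \<open>M\<close> and \<open>R'\<close>
    its inverse; conjugation by \<open>R\<close> turns the generally nonsymmetric product of the
    inverse of \<open>M\<close> with \<open>H\<close> into the symmetric matrix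
    \<open>A\<close>.\<close>
  define R where "R = circulation_matrix (\<lambda>i. sqrt (\<Gamma> i))"
  define R' where "R' = circulation_matrix (\<lambda>i. 1 / sqrt (\<Gamma> i))"
  define A where "A = R' ** H ** R'"
  have inj: "inj (pos z)" using assms(2) by (simp add: relative_equilibrium_def)
  have \<Gamma>0: "\<Gamma> i \<noteq> 0" "sqrt (\<Gamma> i) * sqrt (\<Gamma> i) = \<Gamma> i" for i using assms(1)[of i] by auto
  have R: "R ** R' = mat 1" "R' ** R = mat 1" "R ** R = M"
    by (simp_all add: R_def R'_def M_def circulation_matrix_mult circulation_matrix_1 \<Gamma>0 abs_of_pos assms(1))
  have R3: "X ** R ** R' = X" "X ** R' ** R = X" for X :: "real ^ ('n \<times> 2) ^ ('n \<times> 2)"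
    by (simp_all add: matrix_mul_assoc[symmetric] R)
  have KR: "K_mat ** R = R ** K_mat" "K_mat ** R' = R' ** K_mat"
    by (simp_all add: R_def R'_def K_mat_circulation_matrix)
  have Rt: "transpose R = R" "transpose R' = R'"
    by (simp_all add: R_def R'_def transpose_circulation_matrix)
  have symA: "transpose A = A"
    by (simp add: A_def matrix_transpose_mul Rt H_def transpose_hessian_hamiltonian[OF inj] matrix_mul_assoc)
  have KA: "K_mat ** A = - (A ** K_mat)"
  proof -
    have "K_mat ** A = (K_mat ** R') ** H ** R'" by (simp add: A_def matrix_mul_assoc)
    also have "\<dots> = R' ** (K_mat ** H) ** R'" by (simp add: KR matrix_mul_assoc)
    also have "\<dots> = - (R' ** H ** (K_mat ** R'))"
      unfolding H_def K_mat_hessian_anticommute[OF inj] by (simp add: matrix_ring_simps matrix_mul_assoc)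
    also have "\<dots> = - (A ** K_mat)" by (simp add: KR A_def matrix_mul_assoc)
    finally show ?thesis .
  qed
  obtain P d where P: "orthogonal_matrix P" "A ** P = P ** (\<chi> i j. if i = j then d i else 0)"
    using symmetric_matrix_diagonalization[OF symA] .
  have "matrix_inv M = R' ** R'"
  proof -
    have "M ** (R' ** R') = mat 1" by (simp add: R(3)[symmetric] matrix_mul_assoc R3 R(1))
    then show ?thesis by (rule matrix_inv_unique)
  qed
  then have stab: "stability_matrix \<Gamma> \<omega> z = K_mat ** (R' ** R' ** H + \<omega> *\<^sub>R mat 1)"
    by (simp add: stability_matrix_def M_def H_def)
  \<comment> \<open>\<open>R\<close> commutes with \<open>K_mat\<close>, so the similarity acts only
    on the second factor.\<close>
  have "R ** stability_matrix \<Gamma> \<omega> z ** R' = K_mat ** (A + \<omega> *\<^sub>R mat 1)"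
  proof -
    have "R ** stability_matrix \<Gamma> \<omega> z ** R' = K_mat ** R ** (R' ** R' ** H + \<omega> *\<^sub>R mat 1) ** R'"
      by (simp add: stab KR matrix_mul_assoc)
    then show ?thesis by (simp add: matrix_ring_simps matrix_mul_assoc R3 A_def)
  qed
  then have "charpoly (stability_matrix \<Gamma> \<omega> z) = charpoly (K_mat ** (A + \<omega> *\<^sub>R mat 1))"
    using charpoly_similar[OF R(1), of "stability_matrix \<Gamma> \<omega> z"] by simp
  from num_real_eigenvalue_pairs_charpoly_cong[OF this]
  have pairs: "num_real_eigenvalue_pairs (stability_matrix \<Gamma> \<omega> z) = card {i. d i < - \<bar>\<omega>\<bar>}"
    by (simp only: num_real_eigenvalue_pairs_anticommuting[OF symA P K_mat_square transpose_K_mat KA])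
  have form: "v \<bullet> ((H + \<omega> *\<^sub>R M) *v v) = (R *v v) \<bullet> ((A + \<omega> *\<^sub>R mat 1) *v (R *v v))" for v
  proof -
    have "R ** (A + \<omega> *\<^sub>R mat 1) ** R = H + \<omega> *\<^sub>R M"
      by (simp add: matrix_ring_simps A_def matrix_mul_assoc R R3)
    then have "v \<bullet> ((H + \<omega> *\<^sub>R M) *v v) = v \<bullet> (R *v ((A + \<omega> *\<^sub>R mat 1) *v (R *v v)))"
      by (simp add: matrix_vector_mul_assoc matrix_mul_assoc)
    then show ?thesis by (simp add: inner_matrix_vector_transpose Rt del: transpose_matrix_vector)
  qed
  have index: "morse_index \<Gamma> \<omega> z = Max {dim V | V. subspace V \<and> V \<subseteq> tangent_space (constraint_set \<Gamma> z) z \<and>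
      (\<forall>v\<in>V. v \<noteq> 0 \<longrightarrow> (R *v v) \<bullet> ((A + \<omega> *\<^sub>R mat 1) *v (R *v v)) < 0)}"
    unfolding morse_index_def H_def[symmetric] M_def[symmetric] form ..
  show ?thesis
  proof (cases "\<exists>i j :: 'n. i \<noteq> j")
    case True
    then have "\<omega> * angular_impulse \<Gamma> z > 0"
      using angular_velocity_times_impulse_pos[OF assms] by blast
    moreover have "angular_impulse \<Gamma> z \<ge> 0"
      unfolding angular_impulse_def using assms(1) by (intro sum_nonneg) (simp add: less_imp_le)
    ultimately have \<omega>: "\<omega> > 0" and I: "angular_impulse \<Gamma> z > 0"
      by (auto simp: zero_less_mult_iff)
    \<comment> \<open>\<open>R\<close> carries generalized eigenvectors of \<open>H\<close> with
      respect to \<open>M\<close> to eigenvectors of \<open>A\<close> with the same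
      eigenvalue.\<close>
    have eigen: "A *v (R *v e) = \<kappa> *\<^sub>R (R *v e)" if "H *v e = \<kappa> *\<^sub>R (M *v e)" for e \<kappa>
    proof -
      have "A *v (R *v e) = R' *v (H *v e)"
        by (simp add: A_def matrix_vector_mul_assoc matrix_mul_assoc R3)
      also have "\<dots> = \<kappa> *\<^sub>R (R *v e)"
        by (simp add: that matrix_vector_mult_scaleR matrix_vector_mul_assoc R(3)[symmetric]
            matrix_mul_assoc R(2))
      finally show ?thesis .
    qed
    have RM: "(R *v v) \<bullet> (R *v e) = v \<bullet> (M *v e)" for v e
      by (simp add: inner_matrix_vector_transpose Rt matrix_vector_mul_assoc R del: transpose_matrix_vector)
    \<comment> \<open>By \<open>RM\<close>, orthogonality of \<open>R *v v\<close> to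
      \<open>R *v e\<close> is orthogonality of \<open>v\<close> and \<open>e\<close> in the
      \<open>M\<close> inner product. Translations, with \<open>\<kappa> = 0\<close>, and the
      dilation, with \<open>\<kappa> = \<omega>\<close>, qualify because
      \<open>\<omega> > 0\<close>; they yield the linearized constraints on center and
      impulse.\<close>
    have tangent: "v \<in> tangent_space (constraint_set \<Gamma> z) z"
      if v: "\<And>f \<kappa>. A *v f = \<kappa> *\<^sub>R f \<Longrightarrow> - \<omega> \<le> \<kappa> \<Longrightarrow> (R *v v) \<bullet> f = 0" for v
    proof (rule tangent_space_constraint_setI[OF assms(1) I])
      have vM: "v \<bullet> (M *v e) = 0" if "H *v e = \<kappa> *\<^sub>R (M *v e)" "- \<omega> \<le> \<kappa>" for e \<kappa>
        using v[OF eigen[OF that(1)] that(2)] by (simp add: RM)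
      have "(\<Sum>i\<in>UNIV. \<Gamma> i *\<^sub>R pos v i) \<bullet> x = 0" for x
        using vM[of "constant_config x" 0] \<omega> hessian_hamiltonian_constant_config[OF inj]
        by (simp add: H_def M_def inner_circulation_matrix inner_sum_left)
      then show "(\<Sum>i\<in>UNIV. \<Gamma> i *\<^sub>R pos v i) = 0" using inner_eq_zero_iff by blast
      show "(\<Sum>i\<in>UNIV. \<Gamma> i * ((pos z i - vorticity_center \<Gamma> z) \<bullet> pos v i)) = 0"
        using vM[OF hessian_hamiltonian_dilation[OF assms(2), folded H_def M_def]] \<omega>
        by (simp add: M_def inner_circulation_matrix inner_commute)
    qed
    \<comment> \<open>Since \<open>\<omega> > 0\<close>, the threshold \<open>- \<omega>\<close> for
      the index agrees with the threshold \<open>- \<bar>\<omega>\<bar>\<close> in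
      \<open>pairs\<close>.\<close>
    have "morse_index \<Gamma> \<omega> z = card {i. d i < - \<omega>}"
      unfolding index by (rule Max_dim_negative_definite[OF P R(2)], rule tangent) blast
    then show ?thesis using pairs \<omega> by simp
  next
    \<comment> \<open>A single vortex is its own center, so the constraint set is one point and the
      index is 0. The Hamiltonian is an empty sum, so every \<open>d i\<close> is 0 and none lies
      below \<open>- \<bar>\<omega>\<bar>\<close>.\<close>
    case False
    then have single: "i = j" for i j :: 'n by blast
    have U: "(UNIV :: 'n set) = {i}" for i using single by blast
    have center: "vorticity_center \<Gamma> w = pos w i" for w i
      using \<Gamma>0(1)[of i] by (simp add: vorticity_center_def U[of i])
    then have "constraint_set \<Gamma> z = {z}"
      by (auto simp: constraint_set_def angular_impulse_def intro: pos_eqI)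
    then have "morse_index \<Gamma> \<omega> z = 0"
      unfolding morse_index_def \<open>constraint_set \<Gamma> z = {z}\<close> tangent_space_singleton
      by (intro Max_eqI) (auto simp: subset_singleton_iff intro!: exI[of _ "{0}"])
    moreover have "d i = 0" for i
    proof -
      have "u \<bullet> (H *v v) = u \<bullet> (0 *v v)" for u v
      proof -
        have "\<not> a < b" for a b :: 'n using single[of a b] by simp
        then have "{(a, b). a < (b::'n)} = {}" by simp
        then show ?thesis
          by (simp add: H_def inner_hessian_hamiltonian[OF inj] hamiltonian_hessian_form_def)
      qed
      then have "H = 0" unfolding matrix_eq using vector_eq_ldot by blast
      then have "A = 0" by (simp add: A_def matrix_eq matrix_vector_mul_assoc[symmetric])
      \<comment> \<open>\<open>P *v axis i 1\<close> is the eigenvector for \<open>d i\<close>, and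
        its eigencoordinate at \<open>i\<close> is 1, so \<open>A = 0\<close> forces
        \<open>d i = 0\<close>.\<close>
      then have "d i * (transpose P *v (P *v axis i 1)) $ i = 0"
        using eigencoordinates[OF P, of "P *v axis i 1" i] by simp
      then show ?thesis
        using P(1) by (simp add: matrix_vector_mul_assoc orthogonal_matrix_def del: transpose_matrix_vector)
    qed
    ultimately show ?thesis using pairs by simp
  qed
qed

end
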